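(* The mass problem "produce an everywhere complex sequence" is not Muchnik reducible to the mass problem "produce a Martin-L\"of random sequence". That is, there exists a Martin-L\"of random sequence $X\in\{0,1\}^{\mathbb{N}}$ (with respect to the uniform measure) such that no sequence $\omega$ Turing reducible to $X$ is $\alpha$-everywhere complex for any $\alpha\in(0,1)$.
   Context: For an infinite binary sequence $\omega=\omega_0\omega_1\dots$, $\omega([i,j))$ denotes the substring $\omega_i\dots\omega_{j-1}$, and $K(u)$ denotes the Kolmogorov complexity of a binary string $u$. A sequence $\omega$ is $\alpha$-everywhere complex if there is a constant $c$ such that $K(\omega([k,k+n)))\ge\alpha n-c$ for all $k,n\ge 0$; it is everywhere complex if it is $\alpha$-everywhere complex for some $\alpha\in(0,1)$. A mass problem $\mathcal{P}\subseteq\{0,1\}^{\mathbb{N}}$ is Muchnik (non-uniformly) reducible to a mass problem $\mathcal{Q}$ if for every $X\in\mathcal{Q}$ there exists $Y\in\mathcal{P}$ that is Turing reducible to $X$ (computable by some oracle machine with oracle $X$). *)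

theory Defs
  imports "HOL-Probability.Probability" "HOL-Library.Nat_Bijection"
begin

section \<open>Oracle partial recursive functions (Kleene basis, unary with Cantor pairing)\<close>

datatype rf = RZero | RSucc | RFst | RSnd | ROracle
  | RComp rf rf | RPair rf rf | RRec rf rf | RMu rf

inductive ev :: "(nat \<Rightarrow> bool) \<Rightarrow> rf \<Rightarrow> nat \<Rightarrow> nat \<Rightarrow> bool" where
  ev_zero: "ev A RZero x 0"
| ev_succ: "ev A RSucc x (Suc x)"
| ev_fst: "ev A RFst x (fst (prod_decode x))"
| ev_snd: "ev A RSnd x (snd (prod_decode x))"
| ev_oracle: "ev A ROracle x (if A x then 1 else 0)"
| ev_comp: "ev A g x y \<Longrightarrow> ev A f y z \<Longrightarrow> ev A (RComp f g) x z"
| ev_pair: "ev A f x a \<Longrightarrow> ev A g x b \<Longrightarrow> ev A (RPair f g) x (prod_encode (a, b))"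
| ev_rec0: "ev A f x y \<Longrightarrow> ev A (RRec f g) (prod_encode (x, 0)) y"
| ev_recS: "ev A (RRec f g) (prod_encode (x, n)) y \<Longrightarrow>
            ev A g (prod_encode (x, prod_encode (n, y))) z \<Longrightarrow>
            ev A (RRec f g) (prod_encode (x, Suc n)) z"
| ev_mu: "ev A f (prod_encode (x, n)) 0 \<Longrightarrow>
          (\<forall>m<n. \<exists>y. ev A f (prod_encode (x, m)) (Suc y)) \<Longrightarrow>
          ev A (RMu f) x n"

type_synonym seq = "nat \<Rightarrow> bool"

text \<open>Bijective coding of binary strings by natural numbers.\<close>
fun str_code :: "bool list \<Rightarrow> nat" where
  "str_code [] = 0"
| "str_code (b # xs) = 2 * str_code xs + 1 + (if b then 1 else 0)"

definition turing_reducible :: "seq \<Rightarrow> seq \<Rightarrow> bool" where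
  "turing_reducible \<omega> X \<longleftrightarrow> (\<exists>f. \<forall>n. ev X f n (if \<omega> n then 1 else 0))"

definition partial_computable :: "(bool list \<Rightarrow> bool list option) \<Rightarrow> bool" where
  "partial_computable M \<longleftrightarrow>
     (\<exists>f. \<forall>p y. M p = Some y \<longleftrightarrow> ev (\<lambda>_. False) f (str_code p) (str_code y))"

definition prefix_free_machine :: "(bool list \<Rightarrow> bool list option) \<Rightarrow> bool" where
  "prefix_free_machine M \<longleftrightarrow> partial_computable M \<and>
     (\<forall>p q. M p \<noteq> None \<longrightarrow> M q \<noteq> None \<longrightarrow> prefix p q \<longrightarrow> p = q)"

definition optimal_machine :: "(bool list \<Rightarrow> bool list option) \<Rightarrow> bool" where
  "optimal_machine U \<longleftrightarrow> prefix_free_machine U \<and>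
     (\<forall>M. prefix_free_machine M \<longrightarrow>
        (\<exists>c. \<forall>p u. M p = Some u \<longrightarrow> (\<exists>q. U q = Some u \<and> length q \<le> length p + c)))"

definition UM :: "bool list \<Rightarrow> bool list option" where
  "UM = (SOME U. optimal_machine U)"

definition K :: "bool list \<Rightarrow> nat" where
  "K u = (LEAST n. \<exists>p. UM p = Some u \<and> length p = n)"

definition substr :: "seq \<Rightarrow> nat \<Rightarrow> nat \<Rightarrow> bool list" where
  "substr \<omega> k n = map \<omega> [k..<k+n]"

definition alpha_everywhere_complex :: "real \<Rightarrow> seq \<Rightarrow> bool" where
  "alpha_everywhere_complex \<alpha> \<omega> \<longleftrightarrow>
     (\<exists>c::real. \<forall>k n. real (K (substr \<omega> k n)) \<ge> \<alpha> * real n - c)"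

definition everywhere_complex :: "seq \<Rightarrow> bool" where
  "everywhere_complex \<omega> \<longleftrightarrow> (\<exists>\<alpha>. 0 < \<alpha> \<and> \<alpha> < 1 \<and> alpha_everywhere_complex \<alpha> \<omega>)"

definition coin :: "seq measure" where
  "coin = PiM UNIV (\<lambda>_::nat. measure_pmf (bernoulli_pmf (1/2)))"

definition is_prefix_of :: "bool list \<Rightarrow> seq \<Rightarrow> bool" where
  "is_prefix_of \<sigma> X \<longleftrightarrow> map X [0..<length \<sigma>] = \<sigma>"

definition ce_set :: "nat set \<Rightarrow> bool" where
  "ce_set W \<longleftrightarrow> (\<exists>f. \<forall>x. x \<in> W \<longleftrightarrow> (\<exists>y. ev (\<lambda>_. False) f x y))"

definition test_level :: "nat set \<Rightarrow> nat \<Rightarrow> bool list set" where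
  "test_level W n = {\<sigma>. prod_encode (n, str_code \<sigma>) \<in> W}"

definition cylinders :: "bool list set \<Rightarrow> seq set" where
  "cylinders S = {X. \<exists>\<sigma>\<in>S. is_prefix_of \<sigma> X}"

definition MLtest :: "nat set \<Rightarrow> bool" where
  "MLtest W \<longleftrightarrow> ce_set W \<and>
     (\<forall>n. measure coin (cylinders (test_level W n)) \<le> (1/2) ^ n)"

definition MLrandom :: "seq \<Rightarrow> bool" where
  "MLrandom X \<longleftrightarrow> (\<forall>W. MLtest W \<longrightarrow> \<not> (\<forall>n. X \<in> cylinders (test_level W n)))"

end

theory Submission
  imports Defs "HOL-Real_Asymp.Real_Asymp"
begin

text \<open>It suffices to show for each oracle program \<open>f\<close>, rate \<open>1 / A\<close> and constant \<open>C\<close> that the oracles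
  from which \<open>f\<close> computes a sequence with \<open>K (substr \<omega> k n) \<ge> n / A - C\<close> for all \<open>k\<close> and \<open>n\<close> form a
  null set: there are countably many such triples, and almost all oracles are Martin-Loef random.

  For every distribution on long sequences there is a list of strings \<open>u\<^sub>0, u\<^sub>1, \<dots>\<close> with
  \<open>length u\<^sub>j \<ge> const * log (s + j)\<close> such that almost every sequence contains one of them. Indeed, consider
  rapidly growing block lengths. The number of distinct blocks of a sequence, measured by its
  logarithm per letter, can drop noticeably only at few of the scales. At a scale where it does not drop,
  the long blocks are a large part of all concatenations of the short
  ones, so a few such concatenations, chosen greedily for each possible set of short blocks, hit most
  of the sequences.

  Since the measure of the oracles on which \<open>f\<close> prints many bits can be
  approximated from below, such a list for the output distribution of \<open>f\<close> can be found by a search,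
  given \<open>s\<close> and a rational approximation of the measure on which \<open>f\<close> is total. Hence \<open>u\<^sub>j\<close> is described by
  the pair \<open>(s, j)\<close> and has complexity far below \<open>length u\<^sub>j / A\<close>.\<close>

section \<open>Computable functions\<close>

abbreviation p1 :: "nat \<Rightarrow> nat" where "p1 x \<equiv> fst (prod_decode x)"
abbreviation p2 :: "nat \<Rightarrow> nat" where "p2 x \<equiv> snd (prod_decode x)"

definition computable :: "(nat \<Rightarrow> nat) \<Rightarrow> bool" where
  "computable g \<longleftrightarrow> (\<exists>f. \<forall>x. ev (\<lambda>_. False) f x (g x))"

definition decidable :: "(nat \<Rightarrow> bool) \<Rightarrow> bool" where
  "decidable P \<longleftrightarrow> computable (\<lambda>x. of_bool (P x))"

named_theorems comp_intros

lemma computable_id [comp_intros]: "computable (\<lambda>x. x)"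
  unfolding computable_def
proof (intro exI allI)
  fix x show "ev (\<lambda>_. False) (RPair RFst RSnd) x x"
    using ev_pair[OF ev_fst[of _ x] ev_snd[of _ x]] by simp
qed

lemma computable_comp: "computable f \<Longrightarrow> computable g \<Longrightarrow> computable (\<lambda>x. f (g x))"
  unfolding computable_def by (meson ev_comp)

lemma computable_const [comp_intros]: "computable (\<lambda>_. n)"
proof (induction n)
  case 0 then show ?case unfolding computable_def by (meson ev_zero)
next
  case (Suc n) then show ?case unfolding computable_def by (meson ev_comp ev_succ)
qed

lemma computable_Suc [comp_intros]: "computable g \<Longrightarrow> computable (\<lambda>x. Suc (g x))"
  unfolding computable_def by (meson ev_comp ev_succ)

lemma computable_p1 [comp_intros]: "computable g \<Longrightarrow> computable (\<lambda>x. p1 (g x))"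
  unfolding computable_def by (meson ev_comp ev_fst)

lemma computable_p2 [comp_intros]: "computable g \<Longrightarrow> computable (\<lambda>x. p2 (g x))"
  unfolding computable_def by (meson ev_comp ev_snd)

lemma computable_pair [comp_intros]:
  "computable g \<Longrightarrow> computable h \<Longrightarrow> computable (\<lambda>x. prod_encode (g x, h x))"
  unfolding computable_def by (meson ev_pair)

text \<open>Functions of several variables are handled through an environment: under a binder, the bound
  variable is \<open>p2 t\<close> and the old environment is \<open>p1 t\<close>.\<close>

lemma computable_rec:
  assumes g: "computable g" and b: "computable b"
    and h: "computable (\<lambda>t. h (p1 t) (p1 (p2 t)) (p2 (p2 t)))"
  shows "computable (\<lambda>x. rec_nat (g x) (\<lambda>n y. h x n y) (b x))"
proof -
  obtain fg where fg: "\<And>x. ev (\<lambda>_. False) fg x (g x)" using g unfolding computable_def by blast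
  obtain fh where fh: "\<And>t. ev (\<lambda>_. False) fh t (h (p1 t) (p1 (p2 t)) (p2 (p2 t)))"
    using h unfolding computable_def by blast
  have "ev (\<lambda>_. False) (RRec fg fh) (prod_encode (x, n)) (rec_nat (g x) (h x) n)" for x n
  proof (induction n)
    case 0 then show ?case by (simp add: ev_rec0 fg)
  next
    case (Suc n) then show ?case
      using ev_recS[OF Suc] fh[of "prod_encode (x, prod_encode (n, rec_nat (g x) (h x) n))"] by simp
  qed
  then have "computable (\<lambda>t. rec_nat (g (p1 t)) (h (p1 t)) (p2 t))"
    unfolding computable_def by (metis prod.collapse prod_decode_inverse)
  from computable_comp[OF this computable_pair[OF computable_id b]] show ?thesis by simp
qed

lemma computable_add [comp_intros]:
  assumes "computable g" "computable h" shows "computable (\<lambda>x. g x + h x)"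
proof -
  have "rec_nat a (\<lambda>n y. Suc y) b = a + b" for a b by (induction b) auto
  then show ?thesis
    using computable_rec[OF assms, of "\<lambda>x n y. Suc y"] by (simp add: comp_intros)
qed

lemma computable_mult [comp_intros]:
  assumes "computable g" "computable h" shows "computable (\<lambda>x. g x * h x)"
proof -
  have "rec_nat 0 (\<lambda>n y. y + a) b = a * b" for a b :: nat by (induction b) auto
  then show ?thesis
    using computable_rec[OF computable_const assms(2), of "\<lambda>x n y. y + g x" 0]
      computable_comp[OF assms(1) computable_p1[OF computable_id]]
    by (simp add: comp_intros)
qed

lemma computable_power [comp_intros]:
  assumes "computable g" "computable h" shows "computable (\<lambda>x. g x ^ h x)"
proof -
  have "rec_nat 1 (\<lambda>n y. y * a) b = a ^ b" for a b :: nat by (induction b) auto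
  then show ?thesis
    using computable_rec[OF computable_const assms(2), of "\<lambda>x n y. y * g x" 1]
      computable_comp[OF assms(1) computable_p1[OF computable_id]]
    by (simp add: comp_intros)
qed

lemma computable_diff [comp_intros]:
  assumes "computable g" "computable h" shows "computable (\<lambda>x. g x - h x)"
proof -
  have "rec_nat 0 (\<lambda>n y. n) b = b - 1" for b :: nat by (induction b) auto
  then have pred: "computable (\<lambda>x. x - 1)"
    using computable_rec[OF computable_const computable_id, of "\<lambda>x n y. n" 0]
    by (simp add: comp_intros)
  have "rec_nat a (\<lambda>n y. y - 1) b = a - b" for a b :: nat by (induction b) auto
  then show ?thesis
    using computable_rec[OF assms, of "\<lambda>x n y. y - 1"]
      computable_comp[OF pred computable_p2[OF computable_p2[OF computable_id]]]
    by simp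
qed

lemma computable_sum [comp_intros]:
  assumes "computable b" "computable (\<lambda>t. h (p1 t) (p2 t))"
  shows "computable (\<lambda>x. \<Sum>i<b x. h x i)"
proof -
  have "rec_nat 0 (\<lambda>n y. y + f n) b = (\<Sum>i<b. f i)" for b and f :: "nat \<Rightarrow> nat"
    by (induction b) auto
  moreover have "computable (\<lambda>t. h (p1 t) (p1 (p2 t)))"
    using computable_comp[OF assms(2), of "\<lambda>t. prod_encode (p1 t, p1 (p2 t))"]
    by (simp add: comp_intros)
  ultimately show ?thesis
    using computable_rec[OF computable_const assms(1), of "\<lambda>x n y. y + h x n" 0]
    by (simp add: comp_intros)
qed

lemma decidable_le [comp_intros]:
  "computable g \<Longrightarrow> computable h \<Longrightarrow> decidable (\<lambda>x. g x \<le> h x)"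
proof -
  assume a: "computable g" "computable h"
  have "of_bool (g x \<le> h x) = 1 - (g x - h x)" for x by auto
  with a show ?thesis unfolding decidable_def by (simp only:) (intro comp_intros)
qed

lemma decidable_not [comp_intros]: "decidable P \<Longrightarrow> decidable (\<lambda>x. \<not> P x)"
proof -
  assume a: "decidable P"
  have "of_bool (\<not> P x) = 1 - (of_bool (P x) :: nat)" for x by auto
  with a show ?thesis unfolding decidable_def by (simp only:) (intro comp_intros)
qed

lemma decidable_conj [comp_intros]:
  "decidable P \<Longrightarrow> decidable Q \<Longrightarrow> decidable (\<lambda>x. P x \<and> Q x)"
  unfolding decidable_def of_bool_conj by (intro comp_intros)

lemma decidable_disj [comp_intros]:
  "decidable P \<Longrightarrow> decidable Q \<Longrightarrow> decidable (\<lambda>x. P x \<or> Q x)"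
  using decidable_not[OF decidable_conj[OF decidable_not decidable_not], of P Q] by simp

lemma decidable_imp [comp_intros]:
  "decidable P \<Longrightarrow> decidable Q \<Longrightarrow> decidable (\<lambda>x. P x \<longrightarrow> Q x)"
  unfolding imp_conv_disj by (intro decidable_disj decidable_not)

lemma decidable_less [comp_intros]:
  "computable g \<Longrightarrow> computable h \<Longrightarrow> decidable (\<lambda>x. g x < h x)"
  unfolding not_le[symmetric] by (intro comp_intros)

lemma decidable_eq [comp_intros]:
  "computable g \<Longrightarrow> computable h \<Longrightarrow> decidable (\<lambda>x. g x = h x)"
  using decidable_conj[OF decidable_le decidable_le, of g h h g] by (simp add: order.eq_iff)

text \<open>The number of counterexamples below the bound is a computable sum. Later predicates are
  phrased with bounded quantifiers so that \<open>comp_intros\<close> can decide them.\<close>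

lemma decidable_ball [comp_intros]:
  assumes "computable b" "decidable (\<lambda>t. P (p1 t) (p2 t))"
  shows "decidable (\<lambda>x. \<forall>i<b x. P x i)"
proof -
  have "(\<forall>i<b x. P x i) \<longleftrightarrow> (\<Sum>i<b x. of_bool (\<not> P x i)) = (0::nat)" for x
    by auto
  then have *: "(\<lambda>x. \<forall>i<b x. P x i) = (\<lambda>x. (\<Sum>i<b x. of_bool (\<not> P x i)) = (0::nat))"
    by (rule ext)
  show ?thesis unfolding *
    by (intro decidable_eq computable_sum computable_const assms(1)
        decidable_not[OF assms(2), unfolded decidable_def])
qed

lemma decidable_bex [comp_intros]:
  assumes "computable b" "decidable (\<lambda>t. P (p1 t) (p2 t))"
  shows "decidable (\<lambda>x. \<exists>i<b x. P x i)"
proof -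
  have "decidable (\<lambda>x. \<not> (\<forall>i<b x. \<not> P x i))"
    by (intro decidable_not decidable_ball assms)
  then show ?thesis by simp
qed

lemma decidable_comp: "decidable P \<Longrightarrow> computable g \<Longrightarrow> decidable (\<lambda>x. P (g x))"
  unfolding decidable_def by (rule computable_comp)

lemma computable_card [comp_intros]:
  assumes "computable b" "decidable (\<lambda>t. P (p1 t) (p2 t))"
  shows "computable (\<lambda>x. card {i. i < b x \<and> P x i})"
proof -
  have "card {i. i < b x \<and> P x i} = (\<Sum>i<b x. of_bool (P x i))" for x
    by (simp add: sum.If_cases of_bool_def Collect_conj_eq lessThan_def)
  then show ?thesis using computable_sum[OF assms(1) assms(2)[unfolded decidable_def]] by simp
qed

text \<open>Expresses that bit \<open>i\<close> of \<open>n\<close> is 1 by arithmetic and bounded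
  quantifiers only, the form that the closure rules for \<open>decidable\<close> handle.\<close>

lemma in_set_decode_iff: "i \<in> set_decode n \<longleftrightarrow> (\<exists>q<Suc n. \<exists>r<2^i. n = (2*q+1)*2^i + r)"
proof
  assume "i \<in> set_decode n"
  then have "odd (n div 2^i)" by (simp add: set_decode_def)
  then obtain q where q: "n div 2^i = 2*q+1" by (elim oddE) 
  then have "n = (2*q+1)*2^i + n mod 2^i" by (metis div_mult_mod_eq)
  moreover have "n mod 2^i < 2^i" by simp
  moreover have "q < Suc n" using q div_le_dividend[of n "2^i"] by linarith
  ultimately show "\<exists>q<Suc n. \<exists>r<2^i. n = (2*q+1)*2^i + r" by blast
next
  assume "\<exists>q<Suc n. \<exists>r<2^i. n = (2*q+1)*2^i + r"
  then obtain q r where "r < 2^i" "n = (2*q+1)*2^i + r" by blast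
  then have "n div 2^i = 2*q+1" by (simp only:) (subst div_mult_self3, auto)
  then show "i \<in> set_decode n" by (simp add: set_decode_def)
qed

lemma decidable_set_decode [comp_intros]:
  assumes "computable g" "computable h" shows "decidable (\<lambda>x. g x \<in> set_decode (h x))"
proof -
  have "decidable (\<lambda>t. p1 t \<in> set_decode (p2 t))"
    unfolding in_set_decode_iff by (intro comp_intros)
  from decidable_comp[OF this computable_pair[OF assms]] show ?thesis by simp
qed

section \<open>Derivations of oracle computations\<close>

lemma ev_functional: "ev A f x y \<Longrightarrow> ev A f x y' \<Longrightarrow> y' = y"
proof (induction arbitrary: y' rule: ev.induct)
  case (ev_zero A x) then show ?case by (cases rule: ev.cases) auto
next
  case (ev_succ A x) then show ?case by (cases rule: ev.cases) auto
next
  case (ev_fst A x) then show ?case by (cases rule: ev.cases) auto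
next
  case (ev_snd A x) then show ?case by (cases rule: ev.cases) auto
next
  case (ev_oracle A x) then show ?case by (cases rule: ev.cases) auto
next
  case (ev_comp A g x y f z)
  from ev_comp.prems ev_comp.IH show ?case by (cases rule: ev.cases) auto
next
  case (ev_pair A f x a g b)
  from ev_pair.prems ev_pair.IH show ?case by (cases rule: ev.cases) auto
next
  case (ev_rec0 A f x y g)
  from ev_rec0.prems ev_rec0.IH show ?case by (cases rule: ev.cases) auto
next
  case (ev_recS A f g x n y z)
  from ev_recS.prems ev_recS.IH show ?case by (cases rule: ev.cases) auto
next
  case (ev_mu A f x n)
  from ev_mu.prems show ?case
  proof (cases rule: ev.cases)
    case (ev_mu)
    have "\<not> y' < n" using ev_mu.IH(2) ev_mu(1) by force
    moreover have "\<not> n < y'" using ev_mu.IH(1) ev_mu(2) by force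
    ultimately show ?thesis by simp
  qed
qed

text \<open>The first component is a tag for the constructor, tested in \<open>justified\<close>
  below; the second holds the codes of the subprograms.\<close>

fun rcode :: "rf \<Rightarrow> nat" where
  "rcode RZero = prod_encode (0, 0)"
| "rcode RSucc = prod_encode (1, 0)"
| "rcode RFst = prod_encode (2, 0)"
| "rcode RSnd = prod_encode (3, 0)"
| "rcode ROracle = prod_encode (4, 0)"
| "rcode (RComp f g) = prod_encode (5, prod_encode (rcode f, rcode g))"
| "rcode (RPair f g) = prod_encode (6, prod_encode (rcode f, rcode g))"
| "rcode (RRec f g) = prod_encode (7, prod_encode (rcode f, rcode g))"
| "rcode (RMu f) = prod_encode (8, rcode f)"

abbreviation triple :: "nat \<Rightarrow> nat \<Rightarrow> nat \<Rightarrow> nat" where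
  "triple e x y \<equiv> prod_encode (e, prod_encode (x, y))"

text \<open>A computation is witnessed by a finite set of triples (program, input, output), encoded by \<open>d\<close>,
  in which each triple follows from others. No order on the triples is needed to exclude circularity,
  since the premises of a triple concern a subprogram, or the same recursion at a smaller argument.\<close>

definition justified :: "(nat \<Rightarrow> nat \<Rightarrow> bool) \<Rightarrow> nat \<Rightarrow> nat \<Rightarrow> nat \<Rightarrow> nat \<Rightarrow> bool" where
  "justified orc d e x y \<longleftrightarrow>
     p1 e = 0 \<and> y = 0 \<or> p1 e = 1 \<and> y = Suc x \<or> p1 e = 2 \<and> y = p1 x \<or> p1 e = 3 \<and> y = p2 x \<or>
     p1 e = 4 \<and> orc x y \<or>
     p1 e = 5 \<and> (\<exists>z<d. triple (p2 (p2 e)) x z \<in> set_decode d \<and> triple (p1 (p2 e)) z y \<in> set_decode d) \<or>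
     p1 e = 6 \<and> (\<exists>u<d. \<exists>v<d. triple (p1 (p2 e)) x u \<in> set_decode d \<and>
        triple (p2 (p2 e)) x v \<in> set_decode d \<and> y = prod_encode (u, v)) \<or>
     p1 e = 7 \<and> (p2 x = 0 \<and> triple (p1 (p2 e)) (p1 x) y \<in> set_decode d \<or>
        (\<exists>n<p2 x. p2 x = Suc n \<and> (\<exists>z<d. triple e (prod_encode (p1 x, n)) z \<in> set_decode d \<and>
           triple (p2 (p2 e)) (triple (p1 x) n z) y \<in> set_decode d))) \<or>
     p1 e = 8 \<and> triple (p2 e) (prod_encode (x, y)) 0 \<in> set_decode d \<and>
        (\<forall>m<y. \<exists>z<d. triple (p2 e) (prod_encode (x, m)) (Suc z) \<in> set_decode d)"

definition valid :: "(nat \<Rightarrow> nat \<Rightarrow> bool) \<Rightarrow> nat \<Rightarrow> bool" where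
  "valid orc d \<longleftrightarrow>
     (\<forall>t<d. t \<in> set_decode d \<longrightarrow> justified orc d (p1 t) (p1 (p2 t)) (p2 (p2 t)))"

lemma set_decode_less: "n \<in> set_decode d \<Longrightarrow> n < d"
proof -
  assume "n \<in> set_decode d"
  then have "odd (d div 2^n)" by (simp add: set_decode_def)
  then have "2^n \<le> d" by (metis div_less even_zero not_le)
  then show ?thesis using less_exp[of n] by linarith
qed

lemma triple_ge: "x \<le> triple e x y" "y \<le> triple e x y"
  using le_prod_encode_2 le_prod_encode_1 le_trans by blast+

text \<open>Inputs and outputs of recorded triples lie below the code \<open>d\<close>, so the
  bounds in \<open>justified\<close>, which serve decidability, exclude no witness.\<close>

lemma triple_mem_less:
  "triple e x y \<in> set_decode d \<Longrightarrow> x < d" "triple e x y \<in> set_decode d \<Longrightarrow> y < d"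
  using set_decode_less triple_ge le_less_trans by blast+

lemma triple_mem_Suc_less: "triple e x (Suc y) \<in> set_decode d \<Longrightarrow> y < d"
  using triple_mem_less(2) by fastforce

lemma valid_justified:
  "valid orc d \<Longrightarrow> triple e x y \<in> set_decode d \<Longrightarrow> justified orc d e x y"
  unfolding valid_def using set_decode_less[of "triple e x y" d] by (metis fst_conv snd_conv prod_encode_inverse)

lemma decidable_valid [comp_intros]:
  assumes "decidable (\<lambda>t. orc (p1 t) (p1 (p2 t)) (p2 (p2 t)))" "computable d"
  shows "decidable (\<lambda>x. valid (orc x) (d x))"
proof -
  have [comp_intros]: "decidable (\<lambda>x. orc (f x) (g x) (h x))"
    if "computable f" "computable g" "computable h" for f g h
    using decidable_comp[OF assms(1), of "\<lambda>x. triple (f x) (g x) (h x)"] that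
    by (simp add: computable_pair)
  have "decidable (\<lambda>t. valid (orc (p1 t)) (p2 t))"
    unfolding valid_def justified_def One_nat_def[symmetric]
    by (intro comp_intros)
  from decidable_comp[OF this computable_pair[OF computable_id assms(2)]]
  show ?thesis by simp
qed

text \<open>Induction on the program, with an inner induction on the counter for
  \<open>RRec\<close>. The relation \<open>orc\<close> may be partial, which admits finite parts of
  an oracle.\<close>

lemma valid_sound:
  assumes d: "valid orc d" and orc: "\<And>x y. orc x y \<Longrightarrow> y = of_bool (A x)"
  shows "triple (rcode f) x y \<in> set_decode d \<Longrightarrow> ev A f x y"
proof (induction f arbitrary: x y)
  case RZero
  from valid_justified[OF d this] show ?case by (auto simp: justified_def ev_zero)
next
  case RSucc
  from valid_justified[OF d this] show ?case by (auto simp: justified_def ev_succ)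
next
  case RFst
  from valid_justified[OF d this] show ?case by (auto simp: justified_def ev_fst)
next
  case RSnd
  from valid_justified[OF d this] show ?case by (auto simp: justified_def ev_snd)
next
  case ROracle
  from valid_justified[OF d this] have "orc x y" by (simp add: justified_def)
  from orc[OF this] show ?case using ev_oracle[of A x] by (simp add: of_bool_def)
next
  case (RComp f g)
  from valid_justified[OF d RComp.prems] obtain z where
    "triple (rcode g) x z \<in> set_decode d" "triple (rcode f) z y \<in> set_decode d"
    by (auto simp: justified_def)
  then show ?case using RComp.IH ev_comp by blast
next
  case (RPair f g)
  from valid_justified[OF d RPair.prems] RPair.IH show ?case
    by (auto simp: justified_def intro: ev_pair)
next
  case (RRec f g)
  have "triple (rcode (RRec f g)) (prod_encode (x, n)) y \<in> set_decode d
     \<Longrightarrow> ev A (RRec f g) (prod_encode (x, n)) y" for x n y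
  proof (induction n arbitrary: y)
    case 0
    from valid_justified[OF d 0] RRec.IH(1) show ?case
      by (auto simp: justified_def intro: ev_rec0)
  next
    case (Suc n)
    from valid_justified[OF d Suc.prems] obtain z where
      "triple (rcode (RRec f g)) (prod_encode (x, n)) z \<in> set_decode d"
      "triple (rcode g) (triple x n z) y \<in> set_decode d"
      by (auto simp: justified_def)
    then show ?case using Suc.IH RRec.IH(2) ev_recS by blast
  qed
  from this[of "p1 x" "p2 x"] RRec.prems show ?case by simp
next
  case (RMu f)
  from valid_justified[OF d RMu.prems] RMu.IH show ?case
    by (auto simp: justified_def intro!: ev_mu) blast
qed

text \<open>Membership and oracle answers occur only positively in \<open>justified\<close>, and its
  bounds grow with \<open>d\<close>. The only query a triple makes is its own input
  \<open>x\<close>.\<close>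

lemma justified_mono:
  assumes "justified orc d e x y" "set_decode d \<subseteq> set_decode d'"
    "\<And>q r. orc q r \<Longrightarrow> q \<le> x \<Longrightarrow> orc' q r"
  shows "justified orc' d' e x y"
proof -
  have le: "d \<le> d'" using assms(2) by (rule subset_decode_imp_le)
  then have lt: "z < d'" if "z < d" for z using that by simp
  show ?thesis
    using assms(1) unfolding justified_def
    by (elim disj_forward conj_forward ex_forward all_forward imp_forward)
      (auto intro: lt assms(3) subsetD[OF assms(2)])
qed

text \<open>Queries are inputs of triples recorded in \<open>d\<close> and hence smaller than
  \<open>d\<close>, so only the oracle below \<open>d\<close> matters.\<close>

lemma valid_mono_oracle:
  assumes "valid orc d" "\<And>q r. q < d \<Longrightarrow> orc q r \<Longrightarrow> orc' q r"
  shows "valid orc' d"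
  unfolding valid_def
proof (intro allI impI)
  fix t assume t: "t < d" "t \<in> set_decode d"
  have "p1 (p2 t) \<le> t" using triple_ge(1)[of "p1 (p2 t)" "p1 t" "p2 (p2 t)"] by simp
  with t justified_mono[of orc d "p1 t" "p1 (p2 t)" "p2 (p2 t)" d orc'] assms
  show "justified orc' d (p1 t) (p1 (p2 t)) (p2 (p2 t))"
    unfolding valid_def by auto
qed

definition derivable :: "(nat \<Rightarrow> nat \<Rightarrow> bool) \<Rightarrow> nat \<Rightarrow> bool" where
  "derivable orc t \<longleftrightarrow> (\<exists>d. valid orc d \<and> t \<in> set_decode d)"

lemma valid_union:
  assumes "valid orc a" "valid orc b"
  shows "valid orc (set_encode (set_decode a \<union> set_decode b))"
proof -
  let ?c = "set_encode (set_decode a \<union> set_decode b)"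
  have c: "set_decode ?c = set_decode a \<union> set_decode b"
    by (simp add: set_encode_inverse)
  have "justified orc ?c (p1 t) (p1 (p2 t)) (p2 (p2 t))"
    if "valid orc u" "t \<in> set_decode u" "set_decode u \<subseteq> set_decode ?c" for t u
    using that justified_mono set_decode_less unfolding valid_def by blast
  with assms c show ?thesis unfolding valid_def[of orc ?c] by blast
qed

lemma derivable_finite:
  assumes "finite S" "\<forall>t\<in>S. derivable orc t"
  shows "\<exists>d. valid orc d \<and> S \<subseteq> set_decode d"
  using assms
proof (induction S)
  case empty
  have "valid orc 0" by (simp add: valid_def)
  then show ?case by blast
next
  case (insert t S)
  then obtain a b where "valid orc a" "t \<in> set_decode a" "valid orc b" "S \<subseteq> set_decode b"
    by (auto simp: derivable_def)
  then show ?case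
    by (intro exI[of _ "set_encode (set_decode a \<union> set_decode b)"])
      (auto simp: valid_union set_encode_inverse)
qed

text \<open>Merge the derivations of the premises and add the conclusion; by monotonicity the old
  triples stay justified in the larger set.\<close>

lemma derivable_step:
  assumes "finite S" "\<forall>t\<in>S. derivable orc t"
    and just: "\<And>d. S \<subseteq> set_decode d \<Longrightarrow> justified orc d e x y"
  shows "derivable orc (triple e x y)"
proof -
  obtain d where d: "valid orc d" "S \<subseteq> set_decode d"
    using derivable_finite[OF assms(1,2)] by blast
  define d' where "d' = set_encode (insert (triple e x y) (set_decode d))"
  have d': "set_decode d' = insert (triple e x y) (set_decode d)"
    unfolding d'_def by (simp add: set_encode_inverse)
  have "valid orc d'"
    unfolding valid_def d'
  proof (intro allI impI, elim insertE)
    fix t assume "t = triple e x y"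
    then show "justified orc d' (p1 t) (p1 (p2 t)) (p2 (p2 t))"
      using just[of d'] d(2) d' by auto
  next
    fix t assume "t \<in> set_decode d"
    then have "justified orc d (p1 t) (p1 (p2 t)) (p2 (p2 t))"
      using d(1) set_decode_less unfolding valid_def by blast
    then show "justified orc d' (p1 t) (p1 (p2 t)) (p2 (p2 t))"
      by (rule justified_mono) (auto simp: d')
  qed
  then show ?thesis unfolding derivable_def using d' by blast
qed

lemma ev_derivable:
  "ev A f x y \<Longrightarrow> derivable (\<lambda>q r. r = of_bool (A q)) (triple (rcode f) x y)"
proof (induction rule: ev.induct)
  case (ev_zero A x) show ?case by (rule derivable_step[of "{}"]) (auto simp: justified_def)
next
  case (ev_succ A x) show ?case by (rule derivable_step[of "{}"]) (auto simp: justified_def)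
next
  case (ev_fst A x) show ?case by (rule derivable_step[of "{}"]) (auto simp: justified_def)
next
  case (ev_snd A x) show ?case by (rule derivable_step[of "{}"]) (auto simp: justified_def)
next
  case (ev_oracle A x) show ?case by (rule derivable_step[of "{}"]) (auto simp: justified_def)
next
  case (ev_comp A g x y f z)
  then show ?case
    by (intro derivable_step[of "{triple (rcode g) x y, triple (rcode f) y z}"])
      (auto simp: justified_def dest: triple_mem_less)
next
  case (ev_pair A f x a g b)
  then show ?case
    by (intro derivable_step[of "{triple (rcode f) x a, triple (rcode g) x b}"])
      (auto simp: justified_def dest: triple_mem_less)
next
  case (ev_rec0 A f x y g)
  then show ?case
    by (intro derivable_step[of "{triple (rcode f) x y}"]) (auto simp: justified_def)
next
  case (ev_recS A f g x n y z)
  then show ?case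
    by (intro derivable_step[of "{triple (rcode (RRec f g)) (prod_encode (x, n)) y,
          triple (rcode g) (triple x n y) z}"])
      (auto simp: justified_def dest: triple_mem_less)
next
  case (ev_mu A f x n)
  \<comment> \<open>The nonzero values at the arguments below \<open>n\<close> are chosen at once;
    finitely many premises result.\<close>
  then obtain h where h: "\<And>m. m < n \<Longrightarrow>
      derivable (\<lambda>q r. r = of_bool (A q)) (triple (rcode f) (prod_encode (x, m)) (Suc (h m)))"
    by metis
  show ?case
  proof (rule derivable_step[of "insert (triple (rcode f) (prod_encode (x, n)) 0)
        ((\<lambda>m. triple (rcode f) (prod_encode (x, m)) (Suc (h m))) ` {..<n})"])
    fix d assume "insert (triple (rcode f) (prod_encode (x, n)) 0)
        ((\<lambda>m. triple (rcode f) (prod_encode (x, m)) (Suc (h m))) ` {..<n}) \<subseteq> set_decode d"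
    then show "justified (\<lambda>q r. r = of_bool (A q)) d (rcode (RMu f)) x n"
      by (auto simp: justified_def dest: triple_mem_Suc_less)
  qed (use h ev_mu.IH in auto)
qed

section \<open>Optimal machines\<close>

text \<open>\<open>RMu\<close> finds the least witness and \<open>RFst\<close> reads the value off
  it; \<open>func\<close> makes the value independent of the witness. The predicate is negated
  because \<open>RMu\<close> searches for 0.\<close>

lemma semidecidable_graph:
  assumes dec: "decidable (\<lambda>t. Q (p1 t) (p2 t))"
    and func: "\<forall>x w w'. Q x w \<longrightarrow> Q x w' \<longrightarrow> p1 w = p1 w'"
  shows "\<exists>f. \<forall>x y. ev (\<lambda>_. False) f x y \<longleftrightarrow> (\<exists>w. Q x w \<and> p1 w = y)"
proof -
  obtain g where g: "\<And>t. ev (\<lambda>_. False) g t (of_bool (\<not> Q (p1 t) (p2 t)))"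
    using decidable_not[OF dec] unfolding decidable_def computable_def by blast
  have g': "ev (\<lambda>_. False) g (prod_encode (x, w)) (of_bool (\<not> Q x w))" for x w
    using g[of "prod_encode (x, w)"] by simp
  have "ev (\<lambda>_. False) (RComp RFst (RMu g)) x y \<longleftrightarrow> (\<exists>w. Q x w \<and> p1 w = y)" for x y
  proof
    assume "ev (\<lambda>_. False) (RComp RFst (RMu g)) x y"
    then obtain w where "ev (\<lambda>_. False) (RMu g) x w" "ev (\<lambda>_. False) RFst w y"
      by (cases rule: ev.cases) auto
    then have "ev (\<lambda>_. False) g (prod_encode (x, w)) 0" "p1 w = y"
      by (auto elim: ev.cases)
    with ev_functional[OF g'[of x w], of 0] show "\<exists>w. Q x w \<and> p1 w = y"
      by (intro exI[of _ w]) (auto simp: of_bool_def split: if_splits)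
  next
    assume "\<exists>w. Q x w \<and> p1 w = y"
    then obtain w where w: "Q x w" "p1 w = y" by blast
    define v where "v = (LEAST w. Q x w)"
    have v: "Q x v" unfolding v_def using w(1) by (rule LeastI)
    have "\<not> Q x m" if "m < v" for m using that not_less_Least unfolding v_def by blast
    then have "\<forall>m<v. \<exists>y. ev (\<lambda>_. False) g (prod_encode (x, m)) (Suc y)"
      using g'[of x] by (metis One_nat_def of_bool_eq(2))
    moreover have "ev (\<lambda>_. False) g (prod_encode (x, v)) 0" using g'[of x v] v by simp
    ultimately have "ev (\<lambda>_. False) (RMu g) x v" by (intro ev_mu)
    moreover have "p1 v = y" using func v w by metis
    ultimately show "ev (\<lambda>_. False) (RComp RFst (RMu g)) x y"
      using ev_comp ev_fst by metis
  qed
  then show ?thesis by blast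
qed

section \<open>Arithmetic of the codes of binary strings\<close>

lemma str_code_append: "str_code (p @ r) = str_code p + 2 ^ length p * str_code r"
  by (induction p) (auto simp: algebra_simps)

text \<open>In binary, \<open>str_code p + 1\<close> consists of the letters of \<open>p\<close>,
  lowest bit first, below a leading 1. Its size therefore determines
  \<open>length p\<close>.\<close>

lemma str_code_bounds: "2 ^ length p \<le> str_code p + 1" "str_code p + 1 < 2 ^ (length p + 1)"
  by (induction p) auto

lemma str_code_inject [simp]: "str_code p = str_code q \<longleftrightarrow> p = q"
proof
  show "str_code p = str_code q \<Longrightarrow> p = q"
  proof (induction p arbitrary: q)
    case Nil then show ?case by (cases q) auto
  next
    case (Cons b p)
    then obtain c r where q: "q = c # r" by (cases q) auto
    have "b = c" 
    proof (rule ccontr)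
      assume "b \<noteq> c"
      then have "even (str_code (b # p)) \<noteq> even (str_code (c # r))" by auto
      with Cons.prems q show False by simp
    qed
    with Cons q show ?case by auto
  qed
qed simp

lemma str_code_surj: "\<exists>p. str_code p = n"
proof (induction n rule: less_induct)
  case (less n)
  show ?case
  proof (cases "n = 0")
    case True then show ?thesis by (metis str_code.simps(1))
  next
    case False
    have "(n - 1) div 2 < n" using False by auto
    then obtain p where p: "str_code p = (n - 1) div 2" using less by blast
    define m where "m = n - 1"
    have "str_code (odd m # p) = 2 * (m div 2) + m mod 2 + 1"
      using p unfolding m_def[symmetric] by (auto simp: odd_iff_mod_2_eq_one even_iff_mod_2_eq_zero)
    also have "\<dots> = n" using False by (simp add: m_def)
    finally show ?thesis by blast
  qed
qed

lemma two_power_interval_unique: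
  fixes k l n :: nat
  assumes "2 ^ k \<le> n" "n < 2 ^ (k + 1)" "2 ^ l \<le> n" "n < 2 ^ (l + 1)"
  shows "k = l"
proof -
  have "(2::nat) ^ k < 2 ^ (l + 1)" "(2::nat) ^ l < 2 ^ (k + 1)" using assms by linarith+
  then have "k < l + 1" "l < k + 1" by (simp_all only: power_strict_increasing_iff one_less_numeral_iff semiring_norm)
  then show ?thesis by simp
qed

text \<open>\<open>k\<close> is the length of the string coded by \<open>a\<close>, and
  \<open>r\<close> codes the remaining letters. The bounds keep the relation decidable.\<close>

definition code_prefix :: "nat \<Rightarrow> nat \<Rightarrow> bool" where
  "code_prefix a b \<longleftrightarrow>
     (\<exists>k<Suc a. \<exists>r<Suc b. 2 ^ k \<le> a + 1 \<and> a + 1 < 2 ^ (k + 1) \<and> b = a + 2 ^ k * r)"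

lemma prefix_iff_code_prefix: "prefix p q \<longleftrightarrow> code_prefix (str_code p) (str_code q)"
proof
  assume "prefix p q"
  then obtain r where q: "q = p @ r" by (auto simp: prefix_def)
  have "length p < 2 ^ length p" by (rule less_exp)
  then have "length p < Suc (str_code p)" using str_code_bounds(1)[of p] by linarith
  moreover have "str_code r < Suc (str_code q)"
    unfolding q str_code_append by (simp add: le_imp_less_Suc trans_le_add2)
  ultimately show "code_prefix (str_code p) (str_code q)"
    unfolding code_prefix_def q str_code_append using str_code_bounds[of p] by blast
next
  assume "code_prefix (str_code p) (str_code q)"
  then obtain k r where kr: "2 ^ k \<le> str_code p + 1" "str_code p + 1 < 2 ^ (k + 1)"
    "str_code q = str_code p + 2 ^ k * r" unfolding code_prefix_def by blast
  have "k = length p" using two_power_interval_unique kr(1,2) str_code_bounds by blast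
  moreover obtain s where "str_code s = r" using str_code_surj by blast
  ultimately have "str_code q = str_code (p @ s)" using kr(3) str_code_append by simp
  then show "prefix p q" by simp
qed

lemma str_code_bit: "i < length p \<Longrightarrow> i \<in> set_decode (str_code p + 1) \<longleftrightarrow> p ! i"
proof (induction p arbitrary: i)
  case (Cons b p)
  have "str_code (b # p) + 1 = of_bool b + 2 * (str_code p + 1)" by simp
  then show ?case using Cons by (cases i) auto
qed simp

lemma machine_of_semidecidable:
  assumes dec: "decidable (\<lambda>t. Q (p1 t) (p2 t))"
    and func: "\<forall>x w w'. Q x w \<longrightarrow> Q x w' \<longrightarrow> p1 w = p1 w'"
  obtains M where "partial_computable M"
    "\<And>p u. M p = Some u \<longleftrightarrow> (\<exists>w. Q (str_code p) w \<and> p1 w = str_code u)"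
proof -
  define R where "R = (\<lambda>p u. \<exists>w. Q (str_code p) w \<and> p1 w = str_code u)"
  define M where "M = (\<lambda>p. if \<exists>u. R p u then Some (SOME u. R p u) else None)"
  have uniq: "u = u'" if "R p u" "R p u'" for p u u'
    using that func unfolding R_def by (metis str_code_inject)
  have M: "M p = Some u \<longleftrightarrow> R p u" for p u
    unfolding M_def using uniq someI[of "R p"] by (auto split: if_splits)
  obtain f where "\<And>x y. ev (\<lambda>_. False) f x y \<longleftrightarrow> (\<exists>w. Q x w \<and> p1 w = y)"
    using semidecidable_graph[OF dec func] by blast
  then have "partial_computable M" unfolding partial_computable_def M R_def by blast
  with that M show ?thesis unfolding R_def by blast
qed

text \<open>A self-delimiting way to attach a number to a string. The number is a program code in
  the optimal machine, and the length of the string itself in the upper bound for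
  \<open>K\<close>.\<close>

definition marked :: "nat \<Rightarrow> bool list \<Rightarrow> bool list" where
  "marked e p = replicate e False @ True # p"

lemma length_marked [simp]: "length (marked e p) = e + 1 + length p"
  by (simp add: marked_def)

text \<open>Leading \<open>False\<close> letters are low-order zeros of
  \<open>str_code q + 1\<close>, so reading off a mark becomes an arithmetical condition.\<close>

lemma str_code_marked: "str_code (marked e p) + 1 = 2 ^ e * (2 * str_code p + 3)"
  by (induction e) (auto simp: marked_def algebra_simps)

lemma marked_iff: "q = marked e p \<longleftrightarrow> str_code q + 1 = 2 ^ e * (2 * str_code p + 3)"
  by (metis add_right_cancel str_code_inject str_code_marked)

lemma prefix_marked: "prefix (marked e p) (marked e' p') \<Longrightarrow> e = e' \<and> prefix p p'"
proof (induction e arbitrary: e')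
  case 0 then show ?case by (cases e') (auto simp: marked_def)
next
  case (Suc e) then show ?case by (cases e') (auto simp: marked_def)
qed

text \<open>\<open>w\<close> packs the output, the input and a coded derivation; the oracle answers
  0 throughout.\<close>

definition halts_at :: "nat \<Rightarrow> nat \<Rightarrow> bool" where
  "halts_at e w \<longleftrightarrow> valid (\<lambda>_ r. r = 0) (p2 (p2 w)) \<and>
     triple e (p1 (p2 w)) (p1 w) \<in> set_decode (p2 (p2 w))"

text \<open>Dropping every computation whose input is comparable with the input of an earlier one makes an
  arbitrary program prefix-free, and changes nothing if it is already so.\<close>

definition accepted :: "nat \<Rightarrow> nat \<Rightarrow> bool" where
  "accepted e w \<longleftrightarrow> halts_at e w \<and> (\<forall>v<w. halts_at e v \<longrightarrow>
     \<not> code_prefix (p1 (p2 v)) (p1 (p2 w)) \<and> \<not> code_prefix (p1 (p2 w)) (p1 (p2 v)))"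

lemma decidable_halts_at: "decidable (\<lambda>t. halts_at (p1 t) (p2 t))"
  unfolding halts_at_def by (intro comp_intros)

lemma decidable_code_prefix: "decidable (\<lambda>t. code_prefix (p1 t) (p2 t))"
  unfolding code_prefix_def by (intro comp_intros)

lemma decidable_halts_at' [comp_intros]:
  "computable g \<Longrightarrow> computable h \<Longrightarrow> decidable (\<lambda>t. halts_at (g t) (h t))"
  using decidable_comp[OF decidable_halts_at computable_pair[of g h]] by simp

lemma decidable_code_prefix' [comp_intros]:
  "computable g \<Longrightarrow> computable h \<Longrightarrow> decidable (\<lambda>t. code_prefix (g t) (h t))"
  using decidable_comp[OF decidable_code_prefix computable_pair[of g h]] by simp

lemma decidable_accepted: "decidable (\<lambda>t. accepted (p1 t) (p2 t))"
  unfolding accepted_def by (intro comp_intros)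

lemma decidable_accepted' [comp_intros]:
  "computable g \<Longrightarrow> computable h \<Longrightarrow> decidable (\<lambda>t. accepted (g t) (h t))"
  using decidable_comp[OF decidable_accepted computable_pair[of g h]] by simp

text \<open>If the two differed, the later one would have been dropped because of the earlier
  one.\<close>

lemma accepted_unique:
  assumes "accepted e v" "accepted e w" "code_prefix (p1 (p2 v)) (p1 (p2 w))"
  shows "v = w"
  using assms unfolding accepted_def by (metis linorder_neqE_nat)

lemma halts_at_ev: "halts_at (rcode f) w \<Longrightarrow> ev (\<lambda>_. False) f (p1 (p2 w)) (p1 w)"
  unfolding halts_at_def by (rule valid_sound) auto

lemma ev_halts_at:
  assumes "ev (\<lambda>_. False) f x y"
  shows "\<exists>w. halts_at (rcode f) w \<and> p1 (p2 w) = x \<and> p1 w = y"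
proof -
  obtain d where "valid (\<lambda>q r. r = 0) d" "triple (rcode f) x y \<in> set_decode d"
    using ev_derivable[OF assms] unfolding derivable_def by auto
  then show ?thesis
    by (intro exI[of _ "prod_encode (y, prod_encode (x, d))"]) (simp add: halts_at_def)
qed

text \<open>The machine reads a program code in unary and then runs the pruned program on the rest
  of its input. A prefix-free program keeps its least computation on each input of its domain, so it
  is simulated at the cost of \<open>rcode f + 1\<close> more letters.\<close>

lemma optimal_machine_exists: "\<exists>U. optimal_machine U"
proof -
  \<comment> \<open>\<open>v\<close> packs the output, the program code and a computation; the last
    equation says that \<open>q\<close> codes the input of that computation, marked with the program
    code.\<close>
  define Q where "Q = (\<lambda>q v. accepted (p1 (p2 v)) (p2 (p2 v)) \<and> p1 (p2 (p2 v)) = p1 v \<and>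
     q + 1 = 2 ^ (p1 (p2 v)) * (2 * p1 (p2 (p2 (p2 v))) + 3))"
  have Q: "Q (str_code q) v \<longleftrightarrow> (\<exists>p. q = marked (p1 (p2 v)) p \<and> str_code p = p1 (p2 (p2 (p2 v))) \<and>
     accepted (p1 (p2 v)) (p2 (p2 v)) \<and> p1 (p2 (p2 v)) = p1 v)" for q v
    using str_code_surj[of "p1 (p2 (p2 (p2 v)))"] unfolding Q_def marked_iff by metis
  have same: "marked e p = marked e' p' \<and> p1 v = p1 v'"
    if "Q (str_code (marked e p)) v" "Q (str_code (marked e' p')) v'"
      "prefix (marked e p) (marked e' p')" for e p e' p' v v'
  proof -
    from that(1) obtain r where r: "marked e p = marked (p1 (p2 v)) r"
        "str_code r = p1 (p2 (p2 (p2 v)))" "accepted (p1 (p2 v)) (p2 (p2 v))" "p1 (p2 (p2 v)) = p1 v"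
      unfolding Q by blast
    from that(2) obtain r' where r': "marked e' p' = marked (p1 (p2 v')) r'"
        "str_code r' = p1 (p2 (p2 (p2 v')))" "accepted (p1 (p2 v')) (p2 (p2 v'))"
        "p1 (p2 (p2 v')) = p1 v'"
      unfolding Q by blast
    have eq: "p1 (p2 v) = p1 (p2 v')" "prefix r r'"
      using that(3) prefix_marked unfolding r(1) r'(1) by blast+
    then have "p2 (p2 v) = p2 (p2 v')"
      using accepted_unique r(2,3) r'(2,3) prefix_iff_code_prefix by metis
    with eq r r' show ?thesis by (metis str_code_inject)
  qed
  have same': "p = p' \<and> p1 v = p1 v'"
    if hyp: "Q (str_code p) v" "Q (str_code p') v'" "prefix p p'" for p p' v v'
  proof -
    obtain e r e' r' where "p = marked e r" "p' = marked e' r'" using hyp(1,2) unfolding Q by blast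
    with same hyp show ?thesis by blast
  qed
  have decR: "decidable (\<lambda>t. Q (p1 t) (p2 t))" unfolding Q_def by (intro comp_intros)
  have funcR: "\<forall>x w w'. Q x w \<longrightarrow> Q x w' \<longrightarrow> p1 w = p1 w'"
  proof (intro allI impI)
    fix x w w' assume "Q x w" "Q x w'"
    moreover obtain p where "str_code p = x" using str_code_surj by blast
    ultimately show "p1 w = p1 w'" using same'[of p w p w'] by simp
  qed
  obtain U where U: "partial_computable U"
    "\<And>p u. U p = Some u \<longleftrightarrow> (\<exists>w. Q (str_code p) w \<and> p1 w = str_code u)"
    using machine_of_semidecidable[of Q, OF decR funcR] by blast
  have "prefix_free_machine U"
    unfolding prefix_free_machine_def using U same' by (metis option.exhaust)
  moreover have "\<exists>c. \<forall>p u. M p = Some u \<longrightarrow> (\<exists>q. U q = Some u \<and> length q \<le> length p + c)"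
    if M: "prefix_free_machine M" for M
  proof -
    obtain f where f: "\<And>p y. M p = Some y \<longleftrightarrow> ev (\<lambda>_. False) f (str_code p) (str_code y)"
      using M unfolding prefix_free_machine_def partial_computable_def by blast
    have "U (marked (rcode f) p) = Some u" if "M p = Some u" for p u
    proof -
      let ?P = "\<lambda>w. halts_at (rcode f) w \<and> p1 (p2 w) = str_code p"
      have ev: "ev (\<lambda>_. False) f (str_code p) (str_code u)" using that f by blast
      define w where "w = (LEAST w. ?P w)"
      have w: "halts_at (rcode f) w" "p1 (p2 w) = str_code p"
        using LeastI_ex[of ?P] ev_halts_at[OF ev] unfolding w_def by blast+
      have u: "p1 w = str_code u" using ev_functional[OF ev] halts_at_ev[OF w(1)] w(2) by simp
      \<comment> \<open>An earlier computation with comparable input has its input in the domain of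
        \<open>M\<close>. Prefix-freeness makes the inputs equal, against the choice of
        \<open>w\<close> as the least.\<close>
      have "accepted (rcode f) w"
        unfolding accepted_def
      proof (intro conjI[OF w(1)] allI impI)
        fix v assume v: "v < w" "halts_at (rcode f) v"
        obtain q z where q: "p1 (p2 v) = str_code q" "p1 v = str_code z" 
          using str_code_surj by metis
        then have "M q = Some z" using halts_at_ev[OF v(2)] f by simp
        then have "prefix q p \<Longrightarrow> q = p" "prefix p q \<Longrightarrow> q = p"
          using M that unfolding prefix_free_machine_def by (metis option.distinct(1))+
        moreover have "q \<noteq> p" using not_less_Least[of v ?P] v q unfolding w_def by auto
        ultimately show "\<not> code_prefix (p1 (p2 v)) (p1 (p2 w)) \<and>
            \<not> code_prefix (p1 (p2 w)) (p1 (p2 v))"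
          unfolding q w(2) prefix_iff_code_prefix[symmetric] by blast
      qed
      then have "Q (str_code (marked (rcode f) p)) (prod_encode (str_code u, prod_encode (rcode f, w)))"
        unfolding Q using w u by auto
      then show ?thesis using U(2) by force
    qed
    then have "\<forall>p u. M p = Some u \<longrightarrow> (\<exists>q. U q = Some u \<and> length q \<le> length p + (rcode f + 1))"
      by (metis length_marked add.commute order_refl)
    then show ?thesis by blast
  qed
  ultimately show ?thesis unfolding optimal_machine_def by blast
qed

lemma optimal_UM: "optimal_machine UM"
  unfolding UM_def using optimal_machine_exists by (rule someI_ex)

section \<open>Upper bounds for Kolmogorov complexity\<close>

lemma K_le_prefix_free_machine:
  assumes "prefix_free_machine M"
  shows "\<exists>c. \<forall>p u. M p = Some u \<longrightarrow> K u \<le> length p + c"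
proof -
  obtain c where c: "\<And>p u. M p = Some u \<Longrightarrow> \<exists>q. UM q = Some u \<and> length q \<le> length p + c"
    using optimal_UM assms unfolding optimal_machine_def by blast
  have "K u \<le> length p + c" if Mp: "M p = Some u" for p u
  proof -
    obtain q where "UM q = Some u" "length q \<le> length p + c" using c[OF Mp] by blast
    moreover from this have "K u \<le> length q" unfolding K_def by (intro Least_le) blast
    ultimately show ?thesis by simp
  qed
  then show ?thesis by blast
qed

text \<open>The description of the output at \<open>str_code s\<close> is \<open>s\<close> preceded by its length in unary.\<close>

lemma K_le_semidecidable:
  assumes dec: "decidable (\<lambda>t. Q (p1 t) (p2 t))"
    and func: "\<forall>x w w'. Q x w \<longrightarrow> Q x w' \<longrightarrow> p1 w = p1 w'"
  shows "\<exists>c. \<forall>s w u. Q (str_code s) w \<and> p1 w = str_code u \<longrightarrow> K u \<le> 2 * length s + c"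
proof -
  \<comment> \<open>\<open>v\<close> packs the output, the length of \<open>s\<close>, the code of
    \<open>s\<close> and a witness for \<open>Q\<close>. The two inequalities check the
    length.\<close>
  define R where "R = (\<lambda>q v. q + 1 = 2 ^ (p1 (p2 v)) * (2 * p1 (p2 (p2 v)) + 3) \<and>
      2 ^ (p1 (p2 v)) \<le> p1 (p2 (p2 v)) + 1 \<and> p1 (p2 (p2 v)) + 1 < 2 ^ (p1 (p2 v) + 1) \<and>
      Q (p1 (p2 (p2 v))) (p2 (p2 (p2 v))) \<and> p1 (p2 (p2 (p2 v))) = p1 v)"
  have R: "R (str_code q) v \<longleftrightarrow> (\<exists>s. q = marked (length s) s \<and> p1 (p2 v) = length s \<and>
      p1 (p2 (p2 v)) = str_code s \<and>
      Q (str_code s) (p2 (p2 (p2 v))) \<and> p1 (p2 (p2 (p2 v))) = p1 v)" (is "_ \<longleftrightarrow> ?R") for q v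
  proof
    assume a: "R (str_code q) v"
    obtain s where s: "str_code s = p1 (p2 (p2 v))" using str_code_surj by blast
    then have "p1 (p2 v) = length s"
      using a two_power_interval_unique str_code_bounds[of s] unfolding R_def by metis
    with a s show ?R unfolding R_def marked_iff by metis
  next
    assume ?R
    then show "R (str_code q) v" unfolding R_def using str_code_marked str_code_bounds by auto
  qed
  have same: "p = p' \<and> p1 v = p1 v'"
    if hyp: "R (str_code p) v" "R (str_code p') v'" "prefix p p'" for p p' v v'
  proof -
    from hyp(1,2) obtain s s' where s: "p = marked (length s) s" "Q (str_code s) (p2 (p2 (p2 v)))"
        "p1 (p2 (p2 (p2 v))) = p1 v" and s': "p' = marked (length s') s'"
        "Q (str_code s') (p2 (p2 (p2 v')))" "p1 (p2 (p2 (p2 v'))) = p1 v'"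
      unfolding R by blast
    \<comment> \<open>Equal marks mean equal lengths, and a prefix of the same length is the whole
      string; hence the machine is prefix-free.\<close>
    have "length s = length s'" "prefix s s'" using hyp(3) prefix_marked s(1) s'(1) by blast+
    then have "s = s'" by (auto simp: prefix_def)
    with s s' func show ?thesis by metis
  qed
  have Qc [comp_intros]: "decidable (\<lambda>x. Q (g x) (h x))" if "computable g" "computable h" for g h
    using decidable_comp[OF dec computable_pair[OF that]] by simp
  have decR: "decidable (\<lambda>t. R (p1 t) (p2 t))" unfolding R_def by (intro comp_intros)
  have funcR: "\<forall>x w w'. R x w \<longrightarrow> R x w' \<longrightarrow> p1 w = p1 w'"
  proof (intro allI impI)
    fix x w w' assume "R x w" "R x w'"
    moreover obtain p where "str_code p = x" using str_code_surj by blast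
    ultimately show "p1 w = p1 w'" using same[of p w p w'] by simp
  qed
  obtain M where M: "partial_computable M"
    "\<And>p u. M p = Some u \<longleftrightarrow> (\<exists>w. R (str_code p) w \<and> p1 w = str_code u)"
    using machine_of_semidecidable[of R, OF decR funcR] by blast
  have "prefix_free_machine M"
    unfolding prefix_free_machine_def using M same by (metis option.exhaust)
  then obtain c where c: "\<And>p u. M p = Some u \<Longrightarrow> K u \<le> length p + c"
    using K_le_prefix_free_machine by blast
  have "K u \<le> 2 * length s + (c + 1)" if "Q (str_code s) w" "p1 w = str_code u" for s w u
  proof -
    have "R (str_code (marked (length s) s))
        (prod_encode (str_code u, prod_encode (length s, prod_encode (str_code s, w))))"
      unfolding R using that by auto
    then have "M (marked (length s) s) = Some u" using M(2) by force
    from c[OF this] show ?thesis by simp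
  qed
  then show ?thesis by blast
qed

section \<open>Hitting sequences by few strings\<close>

text \<open>Counting pairs of a remaining \<open>\<omega>\<close> and a string that hits it in two
  ways shows that some string hits at least the fraction \<open>\<epsilon>\<close> of what remains.
  Taking such a string \<open>N\<close> times leaves the fraction
  \<open>(1 - \<epsilon>) ^ N\<close>.\<close>

lemma greedy_hitting:
  fixes \<epsilon> :: real
  assumes fin: "finite \<Omega>" "finite U" "U \<noteq> {}"
    and hit: "\<And>\<omega>. \<omega> \<in> \<Omega> \<Longrightarrow> \<epsilon> * card U \<le> card {u \<in> U. H \<omega> u}"
    and eps: "\<epsilon> \<le> 1"
  shows "\<exists>us. length us = N \<and> set us \<subseteq> U \<and>
    card {\<omega> \<in> \<Omega>. \<forall>u\<in>set us. \<not> H \<omega> u} \<le> (1 - \<epsilon>) ^ N * card \<Omega>"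
proof (induction N)
  case 0
  show ?case by (intro exI[of _ "[]"]) simp
next
  case (Suc N)
  then obtain us where us: "length us = N" "set us \<subseteq> U"
    "card {\<omega> \<in> \<Omega>. \<forall>u\<in>set us. \<not> H \<omega> u} \<le> (1 - \<epsilon>) ^ N * card \<Omega>" by blast
  define R where "R = {\<omega> \<in> \<Omega>. \<forall>u\<in>set us. \<not> H \<omega> u}"
  have finR: "finite R" unfolding R_def using fin by simp
  have "\<exists>u\<in>U. \<epsilon> * card R \<le> card {\<omega> \<in> R. H \<omega> u}"
  proof (rule ccontr)
    assume "\<not> ?thesis"
    then have lt: "real (card {\<omega> \<in> R. H \<omega> u}) < \<epsilon> * card R" if "u \<in> U" for u
      using that by force
    have "\<epsilon> * card U * card R = (\<Sum>\<omega>\<in>R. \<epsilon> * card U)" by simp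
    also have "\<dots> \<le> (\<Sum>\<omega>\<in>R. real (card {u \<in> U. H \<omega> u}))"
      by (intro sum_mono hit) (auto simp: R_def)
    also have "\<dots> = real (\<Sum>\<omega>\<in>R. card {u \<in> U. H \<omega> u})" by simp
    also have "(\<Sum>\<omega>\<in>R. card {u \<in> U. H \<omega> u}) = (\<Sum>u\<in>U. card {\<omega> \<in> R. H \<omega> u})"
      using sum.swap_restrict[OF finR fin(2), of "\<lambda>_ _. 1::nat" H] by simp
    also have "real \<dots> = (\<Sum>u\<in>U. real (card {\<omega> \<in> R. H \<omega> u}))" by simp
    also have "\<dots> < (\<Sum>u\<in>U. \<epsilon> * card R)"
      using fin lt by (intro sum_strict_mono) auto
    finally show False by (simp add: mult_ac)
  qed
  then obtain u where u: "u \<in> U" "\<epsilon> * card R \<le> card {\<omega> \<in> R. H \<omega> u}" by blast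
  have "{\<omega> \<in> \<Omega>. \<forall>v\<in>set (u # us). \<not> H \<omega> v} = R - {\<omega> \<in> R. H \<omega> u}" by (auto simp: R_def)
  then have "real (card {\<omega> \<in> \<Omega>. \<forall>v\<in>set (u # us). \<not> H \<omega> v}) = card R - real (card {\<omega> \<in> R. H \<omega> u})"
    using finR by (simp add: card_Diff_subset of_nat_diff card_mono)
  also have "\<dots> \<le> (1 - \<epsilon>) * card R" using u(2) by (simp add: algebra_simps)
  also have "\<dots> \<le> (1 - \<epsilon>) * ((1 - \<epsilon>) ^ N * card \<Omega>)"
    using us(3) eps unfolding R_def by (intro mult_left_mono) auto
  finally show ?case
    using us u(1) by (intro exI[of _ "u # us"]) (simp add: mult_ac)
qed

text \<open>Allows a separate list for each fibre of \<open>f\<close>. It is applied with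
  \<open>f\<close> the set of short blocks, and again with \<open>f\<close> the chosen
  scale.\<close>

lemma card_missed_partition:
  fixes \<delta> :: real
  assumes fin: "finite \<Omega>"
    and missed: "\<And>T. T \<in> f ` \<Omega> \<Longrightarrow>
      card {\<omega> \<in> \<Omega>. f \<omega> = T \<and> (\<forall>u\<in>G T. \<not> H \<omega> u)} \<le> \<delta> * card {\<omega> \<in> \<Omega>. f \<omega> = T}"
    and F: "\<And>T. T \<in> f ` \<Omega> \<Longrightarrow> G T \<subseteq> F"
  shows "card {\<omega> \<in> \<Omega>. \<forall>u\<in>F. \<not> H \<omega> u} \<le> \<delta> * card \<Omega>"
proof -
  have "card {\<omega> \<in> \<Omega>. \<forall>u\<in>F. \<not> H \<omega> u} \<le>
      card (\<Union>T\<in>f ` \<Omega>. {\<omega> \<in> \<Omega>. f \<omega> = T \<and> (\<forall>u\<in>G T. \<not> H \<omega> u)})"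
    using fin F by (intro card_mono) auto
  also have "\<dots> \<le> (\<Sum>T\<in>f ` \<Omega>. card {\<omega> \<in> \<Omega>. f \<omega> = T \<and> (\<forall>u\<in>G T. \<not> H \<omega> u)})"
    using fin by (intro card_UN_le) auto
  finally have "real (card {\<omega> \<in> \<Omega>. \<forall>u\<in>F. \<not> H \<omega> u}) \<le>
      real (\<Sum>T\<in>f ` \<Omega>. card {\<omega> \<in> \<Omega>. f \<omega> = T \<and> (\<forall>u\<in>G T. \<not> H \<omega> u)})"
    by (rule of_nat_mono)
  also have "\<dots> = (\<Sum>T\<in>f ` \<Omega>. real (card {\<omega> \<in> \<Omega>. f \<omega> = T \<and> (\<forall>u\<in>G T. \<not> H \<omega> u)}))"
    by (rule of_nat_sum)
  also have "\<dots> \<le> (\<Sum>T\<in>f ` \<Omega>. \<delta> * card {\<omega> \<in> \<Omega>. f \<omega> = T})"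
    using missed by (intro sum_mono) blast
  also have "\<dots> = \<delta> * real (\<Sum>T\<in>f ` \<Omega>. card {\<omega> \<in> \<Omega>. f \<omega> = T})"
    by (simp add: sum_distrib_left)
  also have "(\<Sum>T\<in>f ` \<Omega>. card {\<omega> \<in> \<Omega>. f \<omega> = T}) = card \<Omega>"
    using sum.image_gen[OF fin, of "\<lambda>_. 1::nat" f] by simp
  finally show ?thesis .
qed

section \<open>Blocks of a sequence and their number at different scales\<close>

lemma length_substr [simp]: "length (substr x k n) = n"
  by (simp add: substr_def)

lemma substr_add: "substr x a (m + n) = substr x a m @ substr x (a + m) n"
  unfolding substr_def by (simp only: add.assoc[symmetric] upt_add_eq_append[OF le_add1] map_append)

lemma substr_mult: "substr x a (r * n) = concat (map (\<lambda>l. substr x (a + l * n) n) [0..<r])"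
proof (induction r)
  case 0 then show ?case by (simp add: substr_def)
next
  case (Suc r)
  have "Suc r * n = r * n + n" by simp
  then have "substr x a (Suc r * n) = substr x a (r * n) @ substr x (a + r * n) n"
    by (simp only: substr_add)
  then show ?case using Suc by simp
qed

text \<open>Only aligned blocks are taken, so that a block of length \<open>r * n\<close> is a
  concatenation of \<open>r\<close> blocks of length \<open>n\<close>.\<close>

definition blocks :: "nat \<Rightarrow> nat \<Rightarrow> seq \<Rightarrow> bool list set" where
  "blocks L n x = (\<lambda>k. substr x (k * n) n) ` {..<L div n}"

lemma finite_blocks [simp]: "finite (blocks L n x)"
  by (simp add: blocks_def)

lemma blocks_nonempty: "0 < n \<Longrightarrow> n \<le> L \<Longrightarrow> blocks L n x \<noteq> {}"
  by (simp add: blocks_def div_greater_zero_iff lessThan_empty_iff)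

lemma card_blocks_pos: "0 < n \<Longrightarrow> n \<le> L \<Longrightarrow> 0 < card (blocks L n x)"
  using blocks_nonempty by (simp add: card_gt_0_iff)

lemma finite_bool_lists: "finite {u :: bool list. length u = n}"
  using finite_lists_length_eq[of "UNIV :: bool set" n] by simp

lemma card_bool_lists: "card {u :: bool list. length u = n} = 2 ^ n"
  using card_lists_length_eq[of "UNIV :: bool set" n] by simp

lemma blocks_subset: "blocks L n x \<subseteq> {u. length u = n}"
  by (auto simp: blocks_def)

lemma blocks_mult_subset:
  assumes "0 < n"
  shows "blocks L (r * n) x \<subseteq> concat ` {us. set us \<subseteq> blocks L n x \<and> length us = r}"
proof
  fix u assume "u \<in> blocks L (r * n) x"
  then obtain k where k: "k < L div (r * n)" "u = substr x (k * (r * n)) (r * n)"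
    by (auto simp: blocks_def)
  have "substr x (k * (r * n) + l * n) n \<in> blocks L n x" if "l < r" for l
  proof -
    have "(k * r + l + 1) * n \<le> (k * r + r) * n" using that by (intro mult_right_mono) auto
    also have "\<dots> = (k + 1) * (r * n)" by (simp add: algebra_simps)
    also have "\<dots> \<le> L div (r * n) * (r * n)" using k(1) by (intro mult_right_mono) auto
    also have "\<dots> \<le> L" by simp
    finally have "k * r + l < L div n" using assms by (simp add: less_eq_div_iff_mult_less_eq Suc_le_eq[symmetric])
    then show ?thesis unfolding blocks_def
      by (intro image_eqI[of _ _ "k * r + l"]) (simp_all add: algebra_simps)
  qed
  then have "set (map (\<lambda>l. substr x (k * (r * n) + l * n) n) [0..<r]) \<subseteq> blocks L n x" by auto
  then show "u \<in> concat ` {us. set us \<subseteq> blocks L n x \<and> length us = r}"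
    unfolding k(2) substr_mult by (intro imageI) simp
qed

definition occurs :: "nat \<Rightarrow> seq \<Rightarrow> bool list \<Rightarrow> bool" where
  "occurs L x u \<longleftrightarrow> (\<exists>k. k + length u \<le> L \<and> substr x k (length u) = u)"

lemma blocks_occurs:
  assumes "u \<in> blocks L n x" shows "occurs L x u"
proof -
  obtain k where k: "k < L div n" "u = substr x (k * n) n" using assms by (auto simp: blocks_def)
  have "(k + 1) * n \<le> L div n * n" using k(1) by (intro mult_right_mono) auto
  also have "\<dots> \<le> L" by simp
  finally have "k * n + n \<le> L" by simp
  then show ?thesis unfolding occurs_def k(2) by auto
qed

text \<open>If the entropy of the blocks hardly drops from length \<open>n\<close> to length \<open>r * n\<close>, then the
  blocks of length \<open>r * n\<close> make up a large part of the concatenations of blocks of length \<open>n\<close>,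
  and few such concatenations suffice to hit one of them. The set of blocks of
  length \<open>n\<close> is guessed, which is cheap when \<open>r\<close> is large.\<close>

lemma hitting_one_scale:
  fixes \<delta> :: real
  assumes fin: "finite \<Omega>" and n: "0 < n" "0 < r" "r * n \<le> L"
    and t: "exp (- real t) \<le> \<delta>"
    and many: "\<And>\<omega>. \<omega> \<in> \<Omega> \<Longrightarrow> card (blocks L n (x \<omega>)) ^ r \<le> card (blocks L (r * n) (x \<omega>)) * 2 ^ m"
  shows "\<exists>F. length F \<le> 2 ^ 2 ^ n * (2 ^ m * t) \<and> (\<forall>u\<in>set F. length u = r * n) \<and>
    card {\<omega> \<in> \<Omega>. \<forall>u\<in>set F. \<not> occurs L (x \<omega>) u} \<le> \<delta> * card \<Omega>"
proof -
  define f where "f = (\<lambda>\<omega>. blocks L n (x \<omega>))"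
  have "n \<le> r * n" using n(2) by simp
  then have nL: "n \<le> L" using n(3) by (rule le_trans)
  have "\<forall>T\<in>f ` \<Omega>. \<exists>us. length us = 2 ^ m * t \<and> (\<forall>u\<in>set us. length u = r * n) \<and>
      card {\<omega> \<in> \<Omega>. f \<omega> = T \<and> (\<forall>u\<in>set us. \<not> occurs L (x \<omega>) u)} \<le> \<delta> * card {\<omega> \<in> \<Omega>. f \<omega> = T}"
  proof
    fix T assume T\<Omega>: "T \<in> f ` \<Omega>"
    define U where "U = concat ` {us. set us \<subseteq> T \<and> length us = r}"
    have T: "finite T" "T \<subseteq> {u. length u = n}" "T \<noteq> {}"
      using T\<Omega> blocks_subset blocks_nonempty[OF n(1) nL] unfolding f_def by auto
    have finU: "finite U" unfolding U_def using T(1) by (simp add: finite_lists_length_eq)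
    have "card U \<le> card {us. set us \<subseteq> T \<and> length us = r}"
      unfolding U_def by (intro card_image_le finite_lists_length_eq T(1))
    also have "\<dots> = card T ^ r" by (rule card_lists_length_eq[OF T(1)])
    finally have cardU: "card U \<le> card T ^ r" .
    have "U \<noteq> {}"
    proof -
      obtain u where "u \<in> T" using T(3) by blast
      then have "replicate r u \<in> {us. set us \<subseteq> T \<and> length us = r}" by auto
      then show ?thesis unfolding U_def by blast
    qed
    \<comment> \<open>By \<open>many\<close>, the long blocks of each sequence in the fibre form at
      least the fraction \<open>1 / 2 ^ m\<close> of the candidates \<open>U\<close>.\<close>
    moreover have "(1 / 2 ^ m) * real (card U) \<le> card {u \<in> U. u \<in> blocks L (r * n) (x \<omega>)}"
      if "\<omega> \<in> {\<omega> \<in> \<Omega>. f \<omega> = T}" for \<omega>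
    proof -
      have "blocks L (r * n) (x \<omega>) \<subseteq> U"
        using blocks_mult_subset[OF n(1), of L r "x \<omega>"] that unfolding U_def f_def by auto
      then have "{u \<in> U. u \<in> blocks L (r * n) (x \<omega>)} = blocks L (r * n) (x \<omega>)" by blast
      moreover have "card U \<le> card (blocks L (r * n) (x \<omega>)) * 2 ^ m"
        using cardU many[of \<omega>] that unfolding f_def by auto
      then have "real (card U) \<le> real (card (blocks L (r * n) (x \<omega>))) * 2 ^ m"
        using of_nat_mono[where 'a = real] by fastforce
      ultimately show ?thesis by (simp add: divide_simps)
    qed
    ultimately obtain us where us: "length us = 2 ^ m * t" "set us \<subseteq> U"
      "card {\<omega> \<in> {\<omega> \<in> \<Omega>. f \<omega> = T}. \<forall>u\<in>set us. u \<notin> blocks L (r * n) (x \<omega>)}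
        \<le> (1 - 1 / 2 ^ m) ^ (2 ^ m * t) * card {\<omega> \<in> \<Omega>. f \<omega> = T}"
      using greedy_hitting[of "{\<omega> \<in> \<Omega>. f \<omega> = T}" U "1 / 2 ^ m"
          "\<lambda>\<omega> u. u \<in> blocks L (r * n) (x \<omega>)" "2 ^ m * t"] fin finU by auto
    \<comment> \<open>\<open>2 ^ m\<close> greedy rounds gain a factor \<open>exp (- 1)\<close>;
      this is repeated \<open>t\<close> times.\<close>
    have "(1 - 1 / 2 ^ m :: real) ^ (2 ^ m * t) \<le> exp (- (1 / 2 ^ m)) ^ (2 ^ m * t)"
      using exp_ge_add_one_self[of "- (1 / 2 ^ m :: real)"] by (intro power_mono) auto
    also have "\<dots> = exp (- real t)" by (simp add: exp_of_nat_mult[symmetric])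
    also note t
    finally have pw: "(1 - 1 / 2 ^ m :: real) ^ (2 ^ m * t) \<le> \<delta>" .
    have "real (card {\<omega> \<in> \<Omega>. f \<omega> = T \<and> (\<forall>u\<in>set us. \<not> occurs L (x \<omega>) u)}) \<le>
        card {\<omega> \<in> {\<omega> \<in> \<Omega>. f \<omega> = T}. \<forall>u\<in>set us. u \<notin> blocks L (r * n) (x \<omega>)}"
      using fin blocks_occurs by (intro of_nat_mono card_mono) auto
    also note us(3)
    also have "(1 - 1 / 2 ^ m) ^ (2 ^ m * t) * card {\<omega> \<in> \<Omega>. f \<omega> = T} \<le> \<delta> * card {\<omega> \<in> \<Omega>. f \<omega> = T}"
      using pw by (intro mult_right_mono) auto
    finally have "real (card {\<omega> \<in> \<Omega>. f \<omega> = T \<and> (\<forall>u\<in>set us. \<not> occurs L (x \<omega>) u)})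
        \<le> \<delta> * card {\<omega> \<in> \<Omega>. f \<omega> = T}" .
    moreover have "\<forall>u\<in>set us. length u = r * n"
    proof
      fix u assume "u \<in> set us"
      then obtain vs where vs: "u = concat vs" "set vs \<subseteq> T" "length vs = r"
        using us(2) unfolding U_def by auto
      have "map length vs = replicate (length vs) n"
        using vs(2) T(2) by (intro replicate_eqI) auto
      then show "length u = r * n" unfolding vs(1) length_concat using vs(3) by (simp add: sum_list_replicate)
    qed
    ultimately show "\<exists>us. length us = 2 ^ m * t \<and> (\<forall>u\<in>set us. length u = r * n) \<and>
        card {\<omega> \<in> \<Omega>. f \<omega> = T \<and> (\<forall>u\<in>set us. \<not> occurs L (x \<omega>) u)} \<le> \<delta> * card {\<omega> \<in> \<Omega>. f \<omega> = T}"
      using us(1) by blast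
  qed
  from bchoice[OF this] obtain G where G: "\<And>T. T \<in> f ` \<Omega> \<Longrightarrow> length (G T) = 2 ^ m * t \<and>
      (\<forall>u\<in>set (G T). length u = r * n) \<and>
      card {\<omega> \<in> \<Omega>. f \<omega> = T \<and> (\<forall>u\<in>set (G T). \<not> occurs L (x \<omega>) u)} \<le> \<delta> * card {\<omega> \<in> \<Omega>. f \<omega> = T}"
    by blast
  \<comment> \<open>There are \<open>2 ^ 2 ^ n\<close> sets of words of length \<open>n\<close>:
    this is the first factor in the bound on \<open>length F\<close>.\<close>
  have "f ` \<Omega> \<subseteq> Pow {u. length u = n}" using blocks_subset unfolding f_def by auto
  then have "card (f ` \<Omega>) \<le> 2 ^ 2 ^ n"
    using card_mono[of "Pow {u :: bool list. length u = n}" "f ` \<Omega>"]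
    by (simp add: finite_bool_lists card_Pow card_bool_lists)
  then have card_le: "card (f ` \<Omega>) * (2 ^ m * t) \<le> 2 ^ 2 ^ n * (2 ^ m * t)"
    by (rule mult_le_mono1)
  obtain Ts where Ts: "set Ts = f ` \<Omega>" "distinct Ts"
    using finite_distinct_list[of "f ` \<Omega>"] fin by blast
  define F where "F = concat (map G Ts)"
  have "length F = (\<Sum>T\<in>f ` \<Omega>. length (G T))"
    unfolding F_def length_concat using Ts by (simp add: sum_list_distinct_conv_sum_set comp_def)
  also have "\<dots> = card (f ` \<Omega>) * (2 ^ m * t)" using G by simp
  finally have "length F \<le> 2 ^ 2 ^ n * (2 ^ m * t)" using card_le by simp
  moreover have "\<forall>u\<in>set F. length u = r * n" using Ts G unfolding F_def by auto
  moreover have "card {\<omega> \<in> \<Omega>. \<forall>u\<in>set F. \<not> occurs L (x \<omega>) u} \<le> \<delta> * card \<Omega>"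
    using Ts by (intro card_missed_partition[OF fin, of f "\<lambda>T. set (G T)"] conjunct2[OF conjunct2[OF G]])
      (auto simp: F_def)
  ultimately show ?thesis by blast
qed

text \<open>Failure at every \<open>i\<close> costs a factor \<open>2 ^ m (Suc i)\<close> each time
  and gives \<open>d i < 2 ^ (m i * (J - i))\<close> for all \<open>i\<close> from 1 to
  \<open>J\<close>; at \<open>J\<close> this says \<open>d J < 1\<close>. Measured by its logarithm
  per \<open>m i\<close>, \<open>d\<close> starts at no more than \<open>J\<close> and cannot lose 1
  in each of \<open>J\<close> steps.\<close>

lemma entropy_pigeonhole:
  fixes d m r :: "nat \<Rightarrow> nat"
  assumes "0 < J" "d 0 \<le> 2 ^ (J * m 0)" "0 < d J" "\<And>i. m (Suc i) = r i * m i"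
  shows "\<exists>i<J. d i ^ r i \<le> d (Suc i) * 2 ^ m (Suc i)"
proof (rule ccontr)
  assume "\<not> ?thesis"
  then have lt: "d (Suc i) * 2 ^ m (Suc i) < d i ^ r i" if "i < J" for i using that by force
  have step: "d (Suc i) < 2 ^ (m (Suc i) * (J - Suc i))" if "i < J" "d i \<le> 2 ^ (m i * (J - i))" for i
  proof -
    have "d (Suc i) * 2 ^ m (Suc i) < d i ^ r i" using lt that(1) by blast
    also have "\<dots> \<le> (2 ^ (m i * (J - i))) ^ r i" using that(2) by (intro power_mono) auto
    also have "\<dots> = 2 ^ (m (Suc i) * (J - i))" by (simp add: power_mult[symmetric] assms(4) mult_ac)
    also have "m (Suc i) * (J - i) = m (Suc i) * (J - Suc i) + m (Suc i)"
      using that(1) by (metis Suc_diff_Suc add.commute mult_Suc_right)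
    finally show ?thesis by (simp add: power_add)
  qed
  have "i \<le> J \<Longrightarrow> d i \<le> 2 ^ (m i * (J - i))" for i
  proof (induction i)
    case 0 then show ?case using assms(2) by (simp add: mult.commute)
  next
    case (Suc i) then show ?case using step[of i] by simp
  qed
  from step[of "J - 1"] this[of "J - 1"] assms(1,3) show False by simp
qed

text \<open>The pair consists of a scale and of the number of strings that are used up to this scale. The ratio of consecutive
  scales exceeds the logarithm of that number.\<close>

primrec scale :: "nat \<Rightarrow> nat \<Rightarrow> nat \<Rightarrow> nat \<Rightarrow> nat \<times> nat" where
  "scale J s t 0 = (1, 0)"
| "scale J s t (Suc i) = (let (m, b) = scale J s t i; q = 2 ^ 2 ^ (J * m); m' = (s + 2 + b + q * t) * m
     in (m', b + q * (2 ^ m' * t)))"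

text \<open>Each sequence has a scale among \<open>J\<close> at which its block entropy hardly
  drops, and the sequences are split by such a scale. \<open>L\<close> is fixed before
  \<open>\<Omega>\<close> and \<open>x\<close>, since the finite set of oracles will be chosen only
  after \<open>L\<close>.\<close>

lemma hitting_list:
  fixes \<delta> :: real
  assumes e: "0 < e" and \<delta>: "0 < \<delta>"
  shows "\<exists>L\<ge>s. \<forall>(\<Omega> :: 'b set) (x :: 'b \<Rightarrow> seq). finite \<Omega> \<longrightarrow>
    (\<exists>F. (\<forall>j<length F. (s + j + 2) ^ e \<le> 2 ^ length (F ! j)) \<and>
      card {\<omega> \<in> \<Omega>. \<forall>u\<in>set F. \<not> occurs L (x \<omega>) u} \<le> \<delta> * card \<Omega>)"
proof -
  \<comment> \<open>A word of length \<open>J * m i\<close> is then long enough for all positions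
    \<open>j\<close> with \<open>s + j + 2 \<le> 2 ^ (2 * m i)\<close>.\<close>
  define J where "J = 2 * e"
  have J: "0 < J" using e by (simp add: J_def)
  obtain t :: nat where "- ln \<delta> \<le> t" using real_arch_simple by blast
  then have t: "exp (- real t) \<le> \<delta>" using \<delta> by (metis exp_le_cancel_iff exp_ln minus_le_iff)
  define m where "m = (\<lambda>i. fst (scale J s t i))"
  define b where "b = (\<lambda>i. snd (scale J s t i))"
  define r where "r = (\<lambda>i. s + 2 + b i + 2 ^ 2 ^ (J * m i) * t)"
  have m0: "m 0 = 1" and b0: "b 0 = 0" by (simp_all add: m_def b_def)
  have mS: "m (Suc i) = r i * m i" for i
    by (simp add: m_def b_def r_def Let_def case_prod_unfold)
  have bS: "b (Suc i) = b i + 2 ^ 2 ^ (J * m i) * (2 ^ m (Suc i) * t)" for i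
    by (simp add: m_def b_def Let_def case_prod_unfold)
  have r_pos: "0 < r i" for i by (simp add: r_def)
  have m_pos: "0 < m i" for i by (induction i) (auto simp: m0 mS r_pos)
  have m_mono: "m i \<le> m j" if "i \<le> j" for i j
    using that by (rule lift_Suc_mono_le[rotated]) (simp add: mS r_pos Suc_leI)
  \<comment> \<open>\<open>r i\<close> absorbs the earlier strings and the number of guesses: the
    left side is at most \<open>r i * 2 ^ m (Suc i)\<close>, and
    \<open>r i \<le> m (Suc i) < 2 ^ m (Suc i)\<close>.\<close>
  have b_bound: "s + 2 + b (Suc i) \<le> 2 ^ (2 * m (Suc i))" for i
  proof -
    have "s + 2 + b (Suc i) \<le> (s + 2 + b i) * 2 ^ m (Suc i) + 2 ^ 2 ^ (J * m i) * (2 ^ m (Suc i) * t)"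
      unfolding bS using mult_le_mono2[of 1 "2 ^ m (Suc i)" "s + 2 + b i"] by simp
    also have "\<dots> = r i * 2 ^ m (Suc i)" by (simp add: r_def algebra_simps)
    also have "r i \<le> m (Suc i)" using m_pos[of i] by (simp add: mS)
    then have "r i * 2 ^ m (Suc i) \<le> m (Suc i) * 2 ^ m (Suc i)" by (rule mult_right_mono) simp
    also have "\<dots> \<le> 2 ^ m (Suc i) * 2 ^ m (Suc i)"
      using less_exp[of "m (Suc i)"] by (intro mult_right_mono) auto
    finally show ?thesis by (simp add: mult_2 power_add)
  qed
  \<comment> \<open>One block of the last scale, so that at least one block fits at every
    scale.\<close>
  define L where "L = J * m J"
  have JL: "J * m i \<le> L" if "i \<le> J" for i using m_mono[OF that] by (simp add: L_def)
  have "s \<le> m 1" using mS[of 0] by (simp add: m0 r_def)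
  also have "\<dots> \<le> m J" using J by (intro m_mono) simp
  also have "\<dots> \<le> L" using J by (simp add: L_def)
  finally have "s \<le> L" .
  moreover have "\<exists>F. (\<forall>j<length F. (s + j + 2) ^ e \<le> 2 ^ length (F ! j)) \<and>
      card {\<omega> \<in> \<Omega>. \<forall>u\<in>set F. \<not> occurs L (x \<omega>) u} \<le> \<delta> * card \<Omega>"
    if fin: "finite \<Omega>" for \<Omega> :: "'b set" and x :: "'b \<Rightarrow> seq"
  proof -
    define good where "good = (\<lambda>\<omega> i. card (blocks L (J * m i) (x \<omega>)) ^ r i
       \<le> card (blocks L (J * m (Suc i)) (x \<omega>)) * 2 ^ m (Suc i))"
    have ex: "\<exists>i. i < J \<and> good \<omega> i" for \<omega>
      unfolding good_def
    proof (rule entropy_pigeonhole[OF J])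
      show "card (blocks L (J * m 0) (x \<omega>)) \<le> 2 ^ (J * m 0)"
        using card_mono[OF finite_bool_lists blocks_subset] by (simp add: card_bool_lists)
      show "0 < card (blocks L (J * m J) (x \<omega>))"
        using JL[of J] J m_pos by (intro card_blocks_pos) auto
    qed (rule mS)
    \<comment> \<open>Fixing one good scale per sequence turns the scales into a partition of
      \<open>\<Omega>\<close>.\<close>
    define c where "c = (\<lambda>\<omega>. SOME i. i < J \<and> good \<omega> i)"
    have c: "c \<omega> < J" "good \<omega> (c \<omega>)" for \<omega> using someI_ex[OF ex[of \<omega>]] by (simp_all add: c_def)
    have "\<forall>i\<in>{..<J}. \<exists>F. length F \<le> 2 ^ 2 ^ (J * m i) * (2 ^ m (Suc i) * t) \<and> (\<forall>u\<in>set F. length u = J * m (Suc i)) \<and>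
       card {\<omega> \<in> {\<omega> \<in> \<Omega>. c \<omega> = i}. \<forall>u\<in>set F. \<not> occurs L (x \<omega>) u} \<le> \<delta> * card {\<omega> \<in> \<Omega>. c \<omega> = i}"
      (is "\<forall>i\<in>_. ?P i")
    proof
      fix i assume "i \<in> {..<J}"
      then have i: "i < J" by simp
      have eq: "r i * (J * m i) = J * m (Suc i)" by (simp add: mS)
      have "card (blocks L (J * m i) (x \<omega>)) ^ r i \<le> card (blocks L (J * m (Suc i)) (x \<omega>)) * 2 ^ m (Suc i)"
        if "\<omega> \<in> {\<omega> \<in> \<Omega>. c \<omega> = i}" for \<omega> using c(2)[of \<omega>] that unfolding good_def by auto
      moreover have "finite {\<omega> \<in> \<Omega>. c \<omega> = i}" "0 < J * m i" "J * m (Suc i) \<le> L"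
        using fin m_pos[of i] J JL[of "Suc i"] i by auto
      ultimately show "?P i"
        using t r_pos[of i]
        by (intro hitting_one_scale[of "{\<omega> \<in> \<Omega>. c \<omega> = i}" "J * m i" "r i" L t \<delta> x "m (Suc i)", unfolded eq])
    qed
    from bchoice[OF this] obtain G where G: "\<And>i. i < J \<Longrightarrow> length (G i) \<le> 2 ^ 2 ^ (J * m i) * (2 ^ m (Suc i) * t)"
      "\<And>i u. i < J \<Longrightarrow> u \<in> set (G i) \<Longrightarrow> length u = J * m (Suc i)"
      "\<And>i. i < J \<Longrightarrow> card {\<omega> \<in> {\<omega> \<in> \<Omega>. c \<omega> = i}. \<forall>u\<in>set (G i). \<not> occurs L (x \<omega>) u}
          \<le> \<delta> * card {\<omega> \<in> \<Omega>. c \<omega> = i}"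
      unfolding lessThan_iff by blast
    \<comment> \<open>The lists are joined in the order of their scales, so a string added at scale
      \<open>n\<close> stands at a position below \<open>b (Suc n)\<close>.\<close>
    define F where "F = (\<lambda>n. concat (map G [0..<n]))"
    have F: "n \<le> J \<Longrightarrow> length (F n) \<le> b n \<and> (\<forall>j<length (F n). (s + j + 2) ^ e \<le> 2 ^ length (F n ! j))"
      for n
    proof (induction n)
      case 0 then show ?case by (simp add: F_def)
    next
      case (Suc n)
      have FS: "F (Suc n) = F n @ G n" by (simp add: F_def)
      have len: "length (F (Suc n)) \<le> b (Suc n)" using Suc G(1)[of n] by (simp add: FS bS)
      have "(s + j + 2) ^ e \<le> 2 ^ length (F (Suc n) ! j)" if j: "j < length (F (Suc n))" for j
      proof (cases "j < length (F n)")
        case True then show ?thesis using Suc by (simp add: FS nth_append)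
      next
        case False
        then have "F (Suc n) ! j \<in> set (G n)" using j by (simp add: FS nth_append)
        then have lenj: "length (F (Suc n) ! j) = 2 * m (Suc n) * e"
          using G(2)[of n] Suc.prems by (simp add: J_def)
        have "s + j + 2 \<le> 2 ^ (2 * m (Suc n))" using j len b_bound[of n] by linarith
        then have "(s + j + 2) ^ e \<le> (2 ^ (2 * m (Suc n))) ^ e" by (rule power_mono) simp
        then show ?thesis unfolding lenj by (simp only: power_mult)
      qed
      with len show ?case by blast
    qed
    have "card {\<omega> \<in> \<Omega>. \<forall>u\<in>set (F J). \<not> occurs L (x \<omega>) u} \<le> \<delta> * card \<Omega>"
    proof (rule card_missed_partition[OF fin, of c "\<lambda>i. set (G i)"])
      fix i assume "i \<in> c ` \<Omega>"
      then have i: "i < J" using c(1) by auto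
      then show "set (G i) \<subseteq> set (F J)" by (auto simp: F_def)
      show "card {\<omega> \<in> \<Omega>. c \<omega> = i \<and> (\<forall>u\<in>set (G i). \<not> occurs L (x \<omega>) u)} \<le> \<delta> * card {\<omega> \<in> \<Omega>. c \<omega> = i}"
        using G(3)[OF i] by (simp add: conj_assoc)
    qed
    then show ?thesis using F[of J] by blast
  qed
  ultimately show ?thesis by blast
qed


section \<open>Coin tossing\<close>

lemma prob_space_coin: "prob_space coin"
  unfolding coin_def by (intro prob_space_PiM measure_pmf.prob_space_axioms)

interpretation coin: prob_space coin
  by (rule prob_space_coin)

lemma space_coin [simp]: "space coin = UNIV"
  by (auto simp: coin_def space_PiM PiE_UNIV_domain)

definition pre :: "nat \<Rightarrow> seq \<Rightarrow> nat" where
  "pre m X = set_encode {i. i < m \<and> X i}"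

lemma set_decode_pre: "i \<in> set_decode (pre m X) \<longleftrightarrow> i < m \<and> X i"
  by (simp add: pre_def set_encode_inverse)

lemma set_decode_subset_iff_less: "set_decode \<sigma> \<subseteq> {..<m} \<longleftrightarrow> \<sigma> < 2 ^ m"
proof
  assume "set_decode \<sigma> \<subseteq> {..<m}"
  then have "\<sigma> \<le> set_encode {..<m}"
    using subset_decode_imp_le[of \<sigma> "set_encode {..<m}"] by (simp add: set_encode_inverse)
  also have "\<dots> = (\<Sum>i<m. 2 ^ i)" by (simp add: set_encode_def)
  also have "\<dots> < 2 ^ m" by (induction m) auto
  finally show "\<sigma> < 2 ^ m" .
next
  assume \<sigma>: "\<sigma> < 2 ^ m"
  show "set_decode \<sigma> \<subseteq> {..<m}"
  proof
    fix i assume "i \<in> set_decode \<sigma>"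
    then have "\<sigma> div 2 ^ i \<noteq> 0" by (metis even_zero set_decode_def mem_Collect_eq)
    then have "2 ^ i \<le> \<sigma>" by (metis div_less not_le)
    then have "(2::nat) ^ i < 2 ^ m" using \<sigma> by (rule le_less_trans)
    then have "i < m" by (rule power_less_imp_less_exp[rotated]) simp
    then show "i \<in> {..<m}" by simp
  qed
qed

lemma pre_less: "pre m X < 2 ^ m"
  unfolding set_decode_subset_iff_less[symmetric] by (auto simp: set_decode_pre)

lemma pre_eq_iff: "\<sigma> < 2 ^ m \<Longrightarrow> pre m X = \<sigma> \<longleftrightarrow> (\<forall>i<m. X i \<longleftrightarrow> i \<in> set_decode \<sigma>)"
  unfolding set_decode_subset_iff_less[symmetric]
  by (metis (mono_tags, lifting) lessThan_iff set_decode_inverse set_decode_pre subsetD subsetI subset_antisym)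

lemma coin_agree:
  "{X. \<forall>i<m. X i \<longleftrightarrow> Y i} \<in> sets coin \<and> measure coin {X. \<forall>i<m. X i \<longleftrightarrow> Y i} = (1/2) ^ m"
proof -
  let ?p = "\<lambda>_::nat. measure_pmf (bernoulli_pmf (1/2))"
  interpret product_prob_space ?p UNIV ..
  have emb: "prod_emb UNIV ?p {..<m} (PiE {..<m} (\<lambda>i. {Y i})) = {X. \<forall>i<m. X i \<longleftrightarrow> Y i}"
  proof (intro set_eqI)
    fix X :: seq
    show "X \<in> prod_emb UNIV ?p {..<m} (PiE {..<m} (\<lambda>i. {Y i})) \<longleftrightarrow> X \<in> {X. \<forall>i<m. X i \<longleftrightarrow> Y i}"
      unfolding prod_emb_iff PiE_iff by (simp add: Ball_def)
  qed
  have "{X. \<forall>i<m. X i \<longleftrightarrow> Y i} \<in> sets coin"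
    unfolding emb[symmetric] coin_def by (intro sets_PiM_I) auto
  moreover have "measure coin {X. \<forall>i<m. X i \<longleftrightarrow> Y i} = (\<Prod>i<m. measure (?p i) {Y i})"
    unfolding emb[symmetric] coin_def by (intro measure_PiM_emb) auto
  moreover have "measure (?p i) {Y i} = 1/2" for i
    by (cases "Y i") (simp_all add: measure_pmf_single)
  ultimately show ?thesis by (simp only: prod_constant card_lessThan simp_thms)
qed

lemma
  assumes "S \<subseteq> {..<2 ^ m}"
  shows sets_pre: "{X. pre m X \<in> S} \<in> sets coin"
    and measure_pre: "measure coin {X. pre m X \<in> S} = card S / 2 ^ m"
proof -
  have eq: "{X. pre m X = \<sigma>} = {X. \<forall>i<m. X i \<longleftrightarrow> i \<in> set_decode \<sigma>}" if "\<sigma> \<in> S" for \<sigma>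
    using pre_eq_iff[of \<sigma> m] assms that by auto
  have UN: "{X. pre m X \<in> S} = (\<Union>\<sigma>\<in>S. {X. pre m X = \<sigma>})" by auto
  have fin: "finite S" using assms finite_subset by blast
  have sets: "{X. pre m X = \<sigma>} \<in> sets coin" if "\<sigma> \<in> S" for \<sigma>
    unfolding eq[OF that] using coin_agree[of m "\<lambda>i. i \<in> set_decode \<sigma>"] by (rule conjunct1)
  show "{X. pre m X \<in> S} \<in> sets coin"
    unfolding UN using fin sets by (intro sets.finite_UN) auto
  have "measure coin {X. pre m X \<in> S} = (\<Sum>\<sigma>\<in>S. measure coin {X. pre m X = \<sigma>})"
    unfolding UN using fin sets
    by (intro coin.finite_measure_finite_Union) (auto simp: disjoint_family_on_def)
  also have "\<dots> = (\<Sum>\<sigma>\<in>S. (1/2) ^ m)"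
    using coin_agree by (intro sum.cong refl) (simp add: eq)
  finally show "measure coin {X. pre m X \<in> S} = card S / 2 ^ m"
    by (simp add: power_one_over divide_simps)
qed

section \<open>Oracle computations with random oracles\<close>

text \<open>Queries at \<open>m\<close> or beyond get no answer. A derivation from this oracle thus
  remains valid for every oracle extending the prefix.\<close>

definition finite_oracle :: "nat \<Rightarrow> nat \<Rightarrow> nat \<Rightarrow> nat \<Rightarrow> bool" where
  "finite_oracle m \<sigma> q r \<longleftrightarrow> q < m \<and> r = of_bool (q \<in> set_decode \<sigma>)"

definition outputs :: "rf \<Rightarrow> nat \<Rightarrow> nat \<Rightarrow> nat \<Rightarrow> nat \<Rightarrow> bool" where
  "outputs f L m \<sigma> d \<longleftrightarrow> valid (finite_oracle m \<sigma>) d \<and>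
     (\<forall>n<L. triple (rcode f) n 0 \<in> set_decode d \<or> triple (rcode f) n 1 \<in> set_decode d)"

text \<open>The same \<open>m\<close> bounds the prefix and the derivation, so a single limit in
  \<open>m\<close> exhausts all computations.\<close>

definition output_oracles :: "rf \<Rightarrow> nat \<Rightarrow> nat \<Rightarrow> nat set" where
  "output_oracles f L m = {\<sigma>. \<sigma> < 2 ^ m \<and> (\<exists>d<m. outputs f L m \<sigma> d)}"

definition total_upto :: "rf \<Rightarrow> nat \<Rightarrow> seq set" where
  "total_upto f L = {X. \<forall>n<L. \<exists>b. ev X f n (of_bool b)}"

lemma finite_oracle_pre: "finite_oracle m (pre m X) q r \<longleftrightarrow> q < m \<and> r = of_bool (X q)"
  by (auto simp: finite_oracle_def set_decode_pre)

lemma outputs_mono: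
  assumes "m \<le> m'" "outputs f L m (pre m X) d" shows "outputs f L m' (pre m' X) d"
  using assms valid_mono_oracle[of "finite_oracle m (pre m X)" d "finite_oracle m' (pre m' X)"]
  unfolding outputs_def finite_oracle_pre by (auto simp: finite_oracle_pre)

lemma valid_pre_sound:
  assumes "valid (finite_oracle m (pre m X)) d" "triple (rcode f) n y \<in> set_decode d"
  shows "ev X f n y"
  using valid_sound[OF assms(1) _ assms(2), of X] by (simp add: finite_oracle_pre)

text \<open>Finitely many derivations merge into one set \<open>d\<close>, whose queries are below
  \<open>d\<close>; a prefix of length at least \<open>d\<close> answers them all.\<close>

lemma total_upto_outputs:
  assumes "X \<in> total_upto f L"
  shows "\<exists>d. \<forall>m\<ge>d. outputs f L m (pre m X) d"
proof -
  obtain b where b: "\<And>n. n < L \<Longrightarrow> ev X f n (of_bool (b n))"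
    using assms bchoice[of "{..<L}" "\<lambda>n b. ev X f n (of_bool b)"] unfolding total_upto_def by blast
  have "\<exists>d. valid (\<lambda>q r. r = of_bool (X q)) d \<and>
      (\<lambda>n. triple (rcode f) n (of_bool (b n))) ` {..<L} \<subseteq> set_decode d"
    using b ev_derivable by (intro derivable_finite) auto
  then obtain d where d: "valid (\<lambda>q r. r = of_bool (X q)) d"
    "\<And>n. n < L \<Longrightarrow> triple (rcode f) n (of_bool (b n)) \<in> set_decode d" by blast
  have "outputs f L m (pre m X) d" if "d \<le> m" for m
    unfolding outputs_def
  proof
    show "valid (finite_oracle m (pre m X)) d"
      using d(1) that by (rule_tac valid_mono_oracle) (auto simp: finite_oracle_pre)
    show "\<forall>n<L. triple (rcode f) n 0 \<in> set_decode d \<or> triple (rcode f) n 1 \<in> set_decode d"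
    proof (intro allI impI)
      fix n assume "n < L"
      from d(2)[OF this] show "triple (rcode f) n 0 \<in> set_decode d \<or> triple (rcode f) n 1 \<in> set_decode d"
        by (cases "b n") auto
    qed
  qed
  then show ?thesis by blast
qed

lemma outputs_total_upto:
  assumes "outputs f L m (pre m X) d" shows "X \<in> total_upto f L"
  unfolding total_upto_def
proof (intro CollectI allI impI)
  fix n assume "n < L"
  then consider "triple (rcode f) n (of_bool False) \<in> set_decode d"
    | "triple (rcode f) n (of_bool True) \<in> set_decode d"
    using assms unfolding outputs_def by auto
  then show "\<exists>b. ev X f n (of_bool b)"
    using assms valid_pre_sound unfolding outputs_def by cases blast+
qed

lemma total_upto_eq: "total_upto f L = (\<Union>m. {X. pre m X \<in> output_oracles f L m})"
proof (intro equalityI subsetI)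
  fix X assume "X \<in> total_upto f L"
  then obtain d where "outputs f L (Suc d) (pre (Suc d) X) d"
    using total_upto_outputs by (meson le_SucI order_refl)
  then have "pre (Suc d) X \<in> output_oracles f L (Suc d)"
    unfolding output_oracles_def using pre_less by blast
  then show "X \<in> (\<Union>m. {X. pre m X \<in> output_oracles f L m})" by blast
qed (auto simp: output_oracles_def intro: outputs_total_upto)

lemma output_oracles_subset: "output_oracles f L m \<subseteq> {..<2 ^ m}"
  by (auto simp: output_oracles_def)

lemma sets_total_upto [measurable]: "total_upto f L \<in> sets coin"
  unfolding total_upto_eq using sets_pre[OF output_oracles_subset] by blast

text \<open>Approximation from below by counting prefixes: a derivation survives when the prefix
  grows, so the sets increase to \<open>total_upto f L\<close>.\<close>

lemma measure_output_oracles_tendsto: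
  "(\<lambda>m. card (output_oracles f L m) / 2 ^ m) \<longlonglongrightarrow> measure coin (total_upto f L)"
proof -
  have "incseq (\<lambda>m. {X. pre m X \<in> output_oracles f L m})"
  proof (rule incseq_SucI, clarify)
    fix m X assume "pre m X \<in> output_oracles f L m"
    then show "pre (Suc m) X \<in> output_oracles f L (Suc m)"
      unfolding output_oracles_def using outputs_mono[of m "Suc m"] pre_less[of "Suc m" X]
      by (auto intro: less_SucI)
  qed
  then have "(\<lambda>m. measure coin {X. pre m X \<in> output_oracles f L m}) \<longlonglongrightarrow> measure coin (total_upto f L)"
    unfolding total_upto_eq using sets_pre[OF output_oracles_subset]
    by (intro coin.finite_Lim_measure_incseq) auto
  then show ?thesis using measure_pre[OF output_oracles_subset] by simp
qed


section \<open>Searching for a hitting list\<close>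

lemma computable_of_bool [comp_intros]: "decidable P \<Longrightarrow> computable (\<lambda>x. of_bool (P x))"
  by (simp only: decidable_def)

text \<open>Here \<open>p2 t\<close> codes a string of length \<open>l\<close>, whose letters are
  the low bits of \<open>p2 t + 1\<close>. Its occurrence is read off the recorded derivation
  \<open>d\<close> instead of the true output, which makes the predicate decidable.\<close>

definition hits :: "rf \<Rightarrow> nat \<Rightarrow> nat \<Rightarrow> nat \<Rightarrow> nat \<Rightarrow> bool" where
  "hits f L m F \<sigma> \<longleftrightarrow> (\<exists>d<m. outputs f L m \<sigma> d \<and>
     (\<exists>k<Suc L. \<exists>t<F. t \<in> set_decode F \<and> (\<exists>l<Suc L. 2 ^ l \<le> p2 t + 1 \<and> p2 t + 1 < 2 ^ (l + 1) \<and>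
        k + l \<le> L \<and> (\<forall>i<l. triple (rcode f) (k + i) (of_bool (i \<in> set_decode (p2 t + 1))) \<in> set_decode d))))"

lemma decidable_finite_oracle [comp_intros]:
  "computable m \<Longrightarrow> computable \<sigma> \<Longrightarrow> computable q \<Longrightarrow> computable r \<Longrightarrow>
     decidable (\<lambda>t. finite_oracle (m t) (\<sigma> t) (q t) (r t))"
  unfolding finite_oracle_def by (intro comp_intros)

lemma decidable_hits: "decidable (\<lambda>t. hits f (p1 t) (p1 (p2 t)) (p1 (p2 (p2 t))) (p2 (p2 (p2 t))))"
  unfolding hits_def outputs_def by (intro comp_intros)

lemma decidable_hits' [comp_intros]:
  assumes "computable L" "computable m" "computable F" "computable \<sigma>"
  shows "decidable (\<lambda>t. hits f (L t) (m t) (F t) (\<sigma> t))"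
proof -
  have "computable (\<lambda>t. prod_encode (L t, prod_encode (m t, prod_encode (F t, \<sigma> t))))"
    by (intro comp_intros assms)
  from decidable_comp[OF decidable_hits this] show ?thesis by simp
qed

text \<open>The number \<open>v\<close> encodes \<open>L\<close>, \<open>m\<close> and a finite set of pairs \<open>(j, str_code (F ! j))\<close>.\<close>

definition hitting_code :: "rf \<Rightarrow> nat \<Rightarrow> nat \<Rightarrow> nat \<Rightarrow> nat \<Rightarrow> nat \<Rightarrow> bool" where
  "hitting_code f e a b s v \<longleftrightarrow> s \<le> p1 v \<and>
     (\<forall>t<p2 (p2 v). t \<in> set_decode (p2 (p2 v)) \<longrightarrow> (s + p1 t + 2) ^ e \<le> p2 t + 1 \<and>
        (\<forall>t'<p2 (p2 v). t' \<in> set_decode (p2 (p2 v)) \<longrightarrow> p1 t = p1 t' \<longrightarrow> t = t')) \<and>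
     a * 2 ^ p1 (p2 v) \<le>
       b * card {\<sigma>. \<sigma> < 2 ^ p1 (p2 v) \<and> hits f (p1 v) (p1 (p2 v)) (p2 (p2 v)) \<sigma>} + 2 * 2 ^ p1 (p2 v)"

lemma decidable_hitting_code: "decidable (\<lambda>t. hitting_code f e a b (p1 t) (p2 t))"
  unfolding hitting_code_def by (intro comp_intros)

lemma decidable_hitting_code' [comp_intros]:
  "computable s \<Longrightarrow> computable v \<Longrightarrow> decidable (\<lambda>t. hitting_code f e a b (s t) (v t))"
  using decidable_comp[OF decidable_hitting_code computable_pair[of s v]] by simp

lemma hits_sound:
  assumes "hits f L m F (pre m X)"
  shows "X \<in> total_upto f L"
    and "\<exists>t\<in>set_decode F. \<exists>u k. p2 t = str_code u \<and> (\<forall>i<length u. ev X f (k + i) (of_bool (u ! i)))"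
proof -
  obtain d k t l where h: "outputs f L m (pre m X) d" "t \<in> set_decode F"
    "2 ^ l \<le> p2 t + 1" "p2 t + 1 < 2 ^ (l + 1)"
    "\<And>i. i < l \<Longrightarrow> triple (rcode f) (k + i) (of_bool (i \<in> set_decode (p2 t + 1))) \<in> set_decode d"
    using assms unfolding hits_def by blast
  show "X \<in> total_upto f L" using h(1) by (rule outputs_total_upto)
  obtain u where u: "str_code u = p2 t" using str_code_surj by blast
  have l: "l = length u"
    using two_power_interval_unique[OF h(3,4)] str_code_bounds[of u] unfolding u by blast
  have "ev X f (k + i) (of_bool (u ! i))" if "i < length u" for i
  proof (rule valid_pre_sound)
    show "valid (finite_oracle m (pre m X)) d" using h(1) unfolding outputs_def by blast
    show "triple (rcode f) (k + i) (of_bool (u ! i)) \<in> set_decode d"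
      using h(5)[of i] str_code_bit[OF that] that unfolding l u by simp
  qed
  then show "\<exists>t\<in>set_decode F. \<exists>u k. p2 t = str_code u \<and>
      (\<forall>i<length u. ev X f (k + i) (of_bool (u ! i)))"
    using h(2) u by metis
qed

text \<open>The total oracle \<open>\<lambda>q. q \<in> set_decode \<sigma>\<close> extends the
  finite one. By functionality of \<open>ev\<close>, its outputs below \<open>L\<close> are those
  recorded in \<open>d\<close>.\<close>

lemma occurs_hits:
  assumes "outputs f L m \<sigma> d" "d < m"
    and t: "t \<in> set_decode F" "p2 t = str_code u"
    and occ: "occurs L (\<lambda>n. ev (\<lambda>q. q \<in> set_decode \<sigma>) f n 1) u"
  shows "hits f L m F \<sigma>"
proof -
  let ?x = "\<lambda>n. ev (\<lambda>q. q \<in> set_decode \<sigma>) f n 1"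
  have val: "triple (rcode f) n (of_bool (?x n)) \<in> set_decode d" if "n < L" for n
  proof -
    have sound: "ev (\<lambda>q. q \<in> set_decode \<sigma>) f n y" if "triple (rcode f) n y \<in> set_decode d" for y
    proof (rule valid_sound[OF _ _ that])
      show "valid (finite_oracle m \<sigma>) d" using assms(1) unfolding outputs_def by blast
    qed (simp add: finite_oracle_def)
    from assms(1) that have "triple (rcode f) n 0 \<in> set_decode d \<or> triple (rcode f) n 1 \<in> set_decode d"
      unfolding outputs_def by blast
    then show ?thesis
    proof
      assume 0: "triple (rcode f) n 0 \<in> set_decode d"
      then have "\<not> ?x n" using ev_functional[OF sound[OF 0], of 1] by auto
      then show ?thesis using 0 by simp
    next
      assume 1: "triple (rcode f) n 1 \<in> set_decode d"
      then show ?thesis using sound[OF 1] by simp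
    qed
  qed
  obtain k where k: "k + length u \<le> L" "substr ?x k (length u) = u"
    using occ unfolding occurs_def by blast
  have "triple (rcode f) (k + i) (of_bool (i \<in> set_decode (p2 t + 1))) \<in> set_decode d"
    if "i < length u" for i
  proof -
    have "substr ?x k (length u) ! i = ?x (k + i)" using that by (simp add: substr_def)
    then have "?x (k + i) = u ! i" using k(2) by simp
    then show ?thesis using val[of "k + i"] k(1) that str_code_bit[OF that] unfolding t(2) by simp
  qed
  moreover have "k < Suc L" "length u < Suc L" using k(1) by simp_all
  ultimately show ?thesis
    unfolding hits_def using assms(1,2) t k(1) str_code_bounds[of u] set_decode_less[OF t(1)]
    by (intro exI[of _ d] conjI exI[of _ k] exI[of _ t] exI[of _ "length u"]) simp_all
qed

text \<open>In units of \<open>1 / b\<close>, one unit is lost by approximating the measure with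
  prefixes of length \<open>m\<close>, and one through the oracles missed by the list. Together they
  are the term \<open>2 * 2 ^ m\<close> in \<open>hitting_code\<close>.\<close>

lemma hitting_code_exists:
  assumes e: "0 < e" and b: "0 < b"
    and a: "\<And>L. real a \<le> real b * measure coin (total_upto f L)"
  shows "\<exists>v. hitting_code f e a b s v"
proof -
  obtain L where L: "s \<le> L" and list: "\<And>(\<Omega> :: nat set) x. finite \<Omega> \<Longrightarrow>
      \<exists>F. (\<forall>j<length F. (s + j + 2) ^ e \<le> 2 ^ length (F ! j)) \<and>
        card {\<omega> \<in> \<Omega>. \<forall>u\<in>set F. \<not> occurs L (x \<omega>) u} \<le> (1 / b) * card \<Omega>"
    using hitting_list[OF e, of "1 / b" s] b by (auto simp del: of_nat_0_less_iff)
  have "measure coin (total_upto f L) - 1 / b < measure coin (total_upto f L)" using b by simp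
  from order_tendstoD(1)[OF measure_output_oracles_tendsto this]
  obtain m where m: "measure coin (total_upto f L) - 1 / b < card (output_oracles f L m) / 2 ^ m"
    by (auto simp: eventually_sequentially)
  let ?\<Omega> = "output_oracles f L m"
  let ?x = "\<lambda>\<sigma> n. ev (\<lambda>q. q \<in> set_decode \<sigma>) f n 1"
  have fin: "finite ?\<Omega>" by (rule finite_subset[OF output_oracles_subset]) simp
  obtain F where F: "\<And>j. j < length F \<Longrightarrow> (s + j + 2) ^ e \<le> 2 ^ length (F ! j)"
    "card {\<sigma> \<in> ?\<Omega>. \<forall>u\<in>set F. \<not> occurs L (?x \<sigma>) u} \<le> (1 / b) * card ?\<Omega>"
    using list[OF fin, of ?x] by blast
  \<comment> \<open>The index stored with each string serves as a key by which the string is later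
    selected.\<close>
  define G where "G = set_encode ((\<lambda>j. prod_encode (j, str_code (F ! j))) ` {..<length F})"
  have G: "set_decode G = (\<lambda>j. prod_encode (j, str_code (F ! j))) ` {..<length F}"
    unfolding G_def by (simp add: set_encode_inverse)
  have "{\<sigma> \<in> ?\<Omega>. \<not> hits f L m G \<sigma>} \<subseteq> {\<sigma> \<in> ?\<Omega>. \<forall>u\<in>set F. \<not> occurs L (?x \<sigma>) u}"
  proof (clarify)
    fix \<sigma> u assume h: "\<sigma> \<in> ?\<Omega>" "\<not> hits f L m G \<sigma>" "u \<in> set F" "occurs L (?x \<sigma>) u"
    obtain j where "j < length F" "F ! j = u" using h(3) by (auto simp: in_set_conv_nth)
    then have "prod_encode (j, str_code u) \<in> set_decode G" unfolding G by auto
    moreover obtain d where "d < m" "outputs f L m \<sigma> d" using h(1) by (auto simp: output_oracles_def)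
    ultimately show False using occurs_hits[of f L m \<sigma> d "prod_encode (j, str_code u)" G u] h by simp
  qed
  then have "card {\<sigma> \<in> ?\<Omega>. \<not> hits f L m G \<sigma>} \<le> card {\<sigma> \<in> ?\<Omega>. \<forall>u\<in>set F. \<not> occurs L (?x \<sigma>) u}"
    using fin by (intro card_mono) simp_all
  then have "real (card {\<sigma> \<in> ?\<Omega>. \<not> hits f L m G \<sigma>}) \<le>
      real (card {\<sigma> \<in> ?\<Omega>. \<forall>u\<in>set F. \<not> occurs L (?x \<sigma>) u})"
    by (rule of_nat_mono)
  also note F(2)
  finally have "real b * card {\<sigma> \<in> ?\<Omega>. \<not> hits f L m G \<sigma>} \<le> real (card ?\<Omega>)"
    using b by (simp add: field_simps)
  also have "card ?\<Omega> \<le> 2 ^ m"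
    using card_mono[OF _ output_oracles_subset[of f L m]] by simp
  then have "real (card ?\<Omega>) \<le> real (2 ^ m)" by (rule of_nat_mono)
  finally have missed: "real b * card {\<sigma> \<in> ?\<Omega>. \<not> hits f L m G \<sigma>} \<le> 2 ^ m" by simp
  let ?H = "{\<sigma>. \<sigma> < 2 ^ m \<and> hits f L m G \<sigma>}"
  have finH: "finite ?H" by (rule finite_subset[of _ "{..<2 ^ m}"]) auto
  have "card ?\<Omega> \<le> card (?H \<union> {\<sigma> \<in> ?\<Omega>. \<not> hits f L m G \<sigma>})"
    using finH fin output_oracles_subset by (intro card_mono) auto
  also have "\<dots> \<le> card ?H + card {\<sigma> \<in> ?\<Omega>. \<not> hits f L m G \<sigma>}" by (rule card_Un_le)
  finally have "real (card ?\<Omega>) \<le> real (card ?H + card {\<sigma> \<in> ?\<Omega>. \<not> hits f L m G \<sigma>})"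
    by (rule of_nat_mono)
  then have "real b * card ?\<Omega> \<le> real b * (card ?H + card {\<sigma> \<in> ?\<Omega>. \<not> hits f L m G \<sigma>})"
    by (rule mult_left_mono) simp
  then have split: "real b * card ?\<Omega> \<le> real b * card ?H + real b * card {\<sigma> \<in> ?\<Omega>. \<not> hits f L m G \<sigma>}"
    by (simp only: of_nat_add distrib_left)
  have "real a * 2 ^ m \<le> (real b * measure coin (total_upto f L)) * 2 ^ m"
    using a by (intro mult_right_mono) auto
  also have "\<dots> \<le> real b * card ?\<Omega> + 2 ^ m"
    using m b by (simp add: field_simps)
  also have "\<dots> \<le> real b * card ?H + 2 * 2 ^ m" using split missed by simp
  finally have "real (a * 2 ^ m) \<le> real (b * card ?H + 2 * 2 ^ m)" by simp
  then have "a * 2 ^ m \<le> b * card ?H + 2 * 2 ^ m" by (simp only: of_nat_le_iff)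
  moreover have "(s + p1 t + 2) ^ e \<le> p2 t + 1" if tG: "t \<in> set_decode G" for t
  proof -
    obtain j where j: "j < length F" "t = prod_encode (j, str_code (F ! j))" using tG unfolding G by blast
    then show ?thesis using F(1)[OF j(1)] str_code_bounds(1)[of "F ! j"] by simp
  qed
  moreover have "t = t'" if "t \<in> set_decode G" "t' \<in> set_decode G" "p1 t = p1 t'" for t t'
    using that unfolding G by auto
  ultimately have "hitting_code f e a b s (prod_encode (L, prod_encode (m, G)))"
    unfolding hitting_code_def using L by simp
  then show ?thesis by blast
qed

section \<open>Complexity of the strings in a hitting list\<close>

lemma Suc_prod_encode_le: "prod_encode (s, j) + 1 \<le> (s + j + 2) ^ 2"
proof -
  have "triangle n \<le> n * Suc n" for n by (simp add: triangle_def)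
  from this[of "s + j"] show ?thesis
    by (simp add: prod_encode_def power2_eq_square algebra_simps)
qed

text \<open>From \<open>s\<close> the least code \<open>v\<close> is found by search, and the index
  then selects a unique string. The pair of \<open>s\<close> and the index is thus a description,
  with a constant that does not depend on \<open>s\<close>.\<close>

lemma K_hitting_code:
  "\<exists>c. \<forall>s v t u q. hitting_code f e a b s v \<longrightarrow> (\<forall>v'<v. \<not> hitting_code f e a b s v') \<longrightarrow>
     t \<in> set_decode (p2 (p2 v)) \<longrightarrow> p2 t = str_code u \<longrightarrow> str_code q = prod_encode (s, p1 t) \<longrightarrow>
     K u \<le> 2 * length q + c"
proof -
  define Q where "Q = (\<lambda>z w. hitting_code f e a b (p1 z) (p2 w) \<and>
     (\<forall>v'<p2 w. \<not> hitting_code f e a b (p1 z) v') \<and> prod_encode (p2 z, p1 w) \<in> set_decode (p2 (p2 (p2 w))))"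
  have dec: "decidable (\<lambda>t. Q (p1 t) (p2 t))" unfolding Q_def by (intro comp_intros)
  have func: "\<forall>x w w'. Q x w \<longrightarrow> Q x w' \<longrightarrow> p1 w = p1 w'"
  proof (intro allI impI)
    fix x w w' assume Q: "Q x w" "Q x w'"
    then have "p2 w = p2 w'" unfolding Q_def by (metis linorder_neqE_nat)
    then have mem: "prod_encode (p2 x, p1 w) \<in> set_decode (p2 (p2 (p2 w)))"
      "prod_encode (p2 x, p1 w') \<in> set_decode (p2 (p2 (p2 w)))"
      using Q unfolding Q_def by simp_all
    have "t = t'" if "t \<in> set_decode (p2 (p2 (p2 w)))" "t' \<in> set_decode (p2 (p2 (p2 w)))"
      "p1 t = p1 t'" for t t'
      using Q(1) that set_decode_less unfolding Q_def hitting_code_def by blast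
    from this[OF mem] have "prod_encode (p2 x, p1 w) = prod_encode (p2 x, p1 w')" by simp
    then show "p1 w = p1 w'" by simp
  qed
  obtain c where c: "\<And>q w u. Q (str_code q) w \<Longrightarrow> p1 w = str_code u \<Longrightarrow> K u \<le> 2 * length q + c"
    using K_le_semidecidable[OF dec func] by blast
  have "K u \<le> 2 * length q + c"
    if "hitting_code f e a b s v" "\<forall>v'<v. \<not> hitting_code f e a b s v'"
      "t \<in> set_decode (p2 (p2 v))" "p2 t = str_code u" "str_code q = prod_encode (s, p1 t)" for s v t u q
  proof (rule c)
    show "Q (str_code q) (prod_encode (str_code u, v))"
      using that unfolding Q_def by (simp add: that(4)[symmetric])
  qed simp
  then show ?thesis by blast
qed

text \<open>The cover consists of the oracles on which \<open>f\<close> prints at least \<open>s\<close> bits that avoid the strings of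
  the least \<open>hitting_code\<close>, for a large \<open>s\<close>.\<close>

lemma complex_outputs_cover:
  assumes A: "0 < A" and b: "0 < b"
  shows "\<exists>N\<in>sets coin. measure coin N \<le> 4 / real b \<and>
    {X. \<exists>\<omega>. (\<forall>n. ev X f n (of_bool (\<omega> n))) \<and>
       (\<forall>k n. real n / real A - real C \<le> K (substr \<omega> k n))} \<subseteq> N"
proof -
  define M where "M = measure coin (\<Inter>L. total_upto f L)"
  have M: "M \<le> measure coin (total_upto f L)" for L
    unfolding M_def by (intro coin.finite_measure_mono) auto
  \<comment> \<open>The real number \<open>M\<close> enters the search only through this integer,
    its value in units of \<open>1 / b\<close> rounded down; as a fixed parameter it affects only
    the constant \<open>c\<close>.\<close>
  define a where "a = nat \<lfloor>real b * M\<rfloor>"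
  have "0 \<le> M" by (simp add: M_def)
  then have a: "real a \<le> real b * M" "real b * M < real a + 1"
    using b by (simp_all add: a_def of_nat_nat)
  \<comment> \<open>Up to constants, the description of the string with index \<open>j\<close> has
    length \<open>4 * log 2 (s + j)\<close>, while \<open>length u / A\<close> is at least
    \<open>8 * log 2 (s + j)\<close>: the upper bound for \<open>K u\<close> is half the lower
    one.\<close>
  define e where "e = 8 * A"
  have e: "0 < e" using A by (simp add: e_def)
  have ex: "\<exists>v. hitting_code f e a b s v" for s
  proof (rule hitting_code_exists[OF e b])
    fix L show "real a \<le> real b * measure coin (total_upto f L)"
      using a(1) M[of L] b by (meson mult_left_mono of_nat_0_le_iff order_trans)
  qed
  obtain c where c: "\<And>s v t u q. hitting_code f e a b s v \<Longrightarrow> \<forall>v'<v. \<not> hitting_code f e a b s v' \<Longrightarrow>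
     t \<in> set_decode (p2 (p2 v)) \<Longrightarrow> p2 t = str_code u \<Longrightarrow> str_code q = prod_encode (s, p1 t) \<Longrightarrow>
     K u \<le> 2 * length q + c"
    using K_hitting_code[of f e a b] by blast
  have "decseq (total_upto f)" by (rule decseq_SucI) (simp add: total_upto_def Collect_mono)
  moreover have "range (total_upto f) \<subseteq> sets coin" using sets_total_upto by blast
  ultimately have "(\<lambda>L. measure coin (total_upto f L)) \<longlonglongrightarrow> M"
    unfolding M_def by (intro coin.finite_Lim_measure_decseq)
  from order_tendstoD(2)[OF this, of "M + 1 / b"] b
  obtain L0 where L0: "\<And>L. L0 \<le> L \<Longrightarrow> measure coin (total_upto f L) < M + 1 / b"
    by (auto simp: eventually_sequentially)
  \<comment> \<open>\<open>L0\<close> brings the measure of \<open>total_upto f L\<close> within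
    \<open>1 / b\<close> of \<open>M\<close>. The other summand outweighs the constants
    \<open>c\<close> and \<open>C\<close>, because \<open>s = 2 ^ n\<close> will force
    \<open>n \<le> length u\<close>.\<close>
  define n where "n = L0 + 2 * A * (1 + c + C) + 1"
  define s where "s = (2::nat) ^ n"
  define v where "v = (LEAST v. hitting_code f e a b s v)"
  have v: "hitting_code f e a b s v" "\<forall>v'<v. \<not> hitting_code f e a b s v'"
    using LeastI_ex[OF ex] not_less_Least unfolding v_def by auto
  define L where "L = p1 v"
  define m where "m = p1 (p2 v)"
  define F where "F = p2 (p2 v)"
  let ?H = "{X. pre m X \<in> {\<sigma>. \<sigma> < 2 ^ m \<and> hits f L m F \<sigma>}}"
  have Hset: "?H \<in> sets coin" by (intro sets_pre) auto
  have "measure coin ?H = card {\<sigma>. \<sigma> < 2 ^ m \<and> hits f L m F \<sigma>} / 2 ^ m"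
    by (intro measure_pre) auto
  then have card: "real (card {\<sigma>. \<sigma> < 2 ^ m \<and> hits f L m F \<sigma>}) = measure coin ?H * 2 ^ m"
    by (simp only: nonzero_eq_divide_eq[OF power_not_zero[OF zero_neq_numeral[symmetric]]])
  have "a * 2 ^ m \<le> b * card {\<sigma>. \<sigma> < 2 ^ m \<and> hits f L m F \<sigma>} + 2 * 2 ^ m"
    using v(1) unfolding hitting_code_def L_def m_def F_def by blast
  then have "real (a * 2 ^ m) \<le> real (b * card {\<sigma>. \<sigma> < 2 ^ m \<and> hits f L m F \<sigma>} + 2 * 2 ^ m)"
    by (simp only: of_nat_le_iff)
  also have "\<dots> = (real b * measure coin ?H + 2) * 2 ^ m"
    unfolding of_nat_add of_nat_mult card by (simp add: algebra_simps)
  finally have "real a * 2 ^ m \<le> (real b * measure coin ?H + 2) * 2 ^ m" by simp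
  then have "real a \<le> real b * measure coin ?H + 2" by (rule mult_right_le_imp_le) simp
  \<comment> \<open>One unit comes from rounding \<open>M\<close>, two from
    \<open>hitting_code\<close>. The fourth unit of the final bound is the gap between
    \<open>M\<close> and the measure at \<open>L\<close>.\<close>
  then have "real b * M < real b * measure coin ?H + 3" using a(2) by simp
  then have MH: "M - measure coin ?H < 3 / b" using b by (simp add: field_simps)
  have HT: "?H \<subseteq> total_upto f L" using hits_sound(1) by blast
  define N where "N = total_upto f L - ?H"
  have "N \<in> sets coin" unfolding N_def using Hset by auto
  moreover have "measure coin N \<le> 4 / b"
  proof -
    have "n < s" unfolding s_def by (rule less_exp)
    moreover have "s \<le> L" using v(1) unfolding hitting_code_def L_def by blast
    ultimately have "measure coin (total_upto f L) < M + 1 / b" by (intro L0) (simp add: n_def)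
    moreover have "measure coin N = measure coin (total_upto f L) - measure coin ?H"
      unfolding N_def using Hset HT by (intro coin.finite_measure_Diff) auto
    ultimately show ?thesis using MH by (simp add: field_simps)
  qed
  moreover have "X \<in> N" if \<omega>: "\<And>n. ev X f n (of_bool (\<omega> n))"
      "\<And>k n. real n / real A - real C \<le> K (substr \<omega> k n)" for X \<omega>
  proof (rule ccontr)
    assume "X \<notin> N"
    moreover have "X \<in> total_upto f L" using \<omega>(1) unfolding total_upto_def by blast
    ultimately have "hits f L m F (pre m X)" unfolding N_def by blast
    then obtain t u k where t: "t \<in> set_decode F" "p2 t = str_code u"
      and u: "\<And>i. i < length u \<Longrightarrow> ev X f (k + i) (of_bool (u ! i))"
      using hits_sound(2) by blast
    \<comment> \<open>The outputs of \<open>f\<close> with oracle \<open>X\<close> are unique, so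
      the string found by \<open>hits\<close> occurs in \<open>\<omega>\<close> itself.\<close>
    have "substr \<omega> k (length u) = u"
    proof (rule nth_equalityI)
      fix i assume i: "i < length (substr \<omega> k (length u))"
      then have "(of_bool (\<omega> (k + i)) :: nat) = of_bool (u ! i)"
        using ev_functional[OF u \<omega>(1)] by simp
      then show "substr \<omega> k (length u) ! i = u ! i"
        using i by (simp add: substr_def of_bool_eq_iff)
    qed simp
    then have low: "real (length u) / real A - real C \<le> K u" using \<omega>(2)[of "length u" k] by simp
    obtain q where q: "str_code q = prod_encode (s, p1 t)" using str_code_surj by blast
    have up: "K u \<le> 2 * length q + c" by (rule c[OF v]) (use t q in \<open>auto simp: F_def\<close>)
    have pw: "(s + p1 t + 2) ^ e < 2 ^ (length u + 1)"
      using v(1) t set_decode_less[OF t(1)] str_code_bounds(2)[of u]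
      unfolding hitting_code_def F_def by fastforce
    have "2 ^ length q \<le> (s + p1 t + 2) ^ 2"
      using str_code_bounds(1)[of q] Suc_prod_encode_le[of s "p1 t"] unfolding q by (rule le_trans)
    then have "(2 ^ length q) ^ e \<le> ((s + p1 t + 2) ^ 2) ^ e" by (rule power_mono) simp
    also have "\<dots> = ((s + p1 t + 2) ^ e) ^ 2" by (simp add: power_mult[symmetric] mult.commute)
    also have "\<dots> < (2 ^ (length u + 1)) ^ 2" using pw by (rule power_strict_mono) simp_all
    finally have "(2::nat) ^ (length q * e) < 2 ^ ((length u + 1) * 2)" by (simp only: power_mult)
    then have "length q * e < (length u + 1) * 2" by (rule power_less_imp_less_exp[rotated]) simp
    then have lq: "4 * (A * length q) < length u + 1" by (simp add: e_def mult_ac)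
    have "(2::nat) ^ n \<le> s + p1 t + 2" by (simp add: s_def)
    also have "\<dots> \<le> (s + p1 t + 2) ^ e" using e by (intro self_le_power) auto
    also note pw
    finally have "n < length u + 1" by (rule power_less_imp_less_exp[rotated]) simp
    then have big: "2 * (A * (1 + c + C)) < length u" by (simp add: n_def mult.assoc)
    have "real (length u) / real A \<le> real (2 * length q + c + C)" using low up by simp
    then have "real (length u) \<le> real ((2 * length q + c + C) * A)" using A by (simp add: field_simps)
    then have "length u \<le> (2 * length q + c + C) * A" by (simp only: of_nat_le_iff)
    then have "2 * length u \<le> 4 * (A * length q) + 2 * (A * (c + C))" by (simp add: algebra_simps)
    also have "\<dots> \<le> length u + 2 * (A * (c + C))" using lq by simp
    also have "\<dots> < length u + length u" using big A by (simp add: algebra_simps)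
    finally show False by simp
  qed
  ultimately show ?thesis by blast
qed

section \<open>Null sets and almost every oracle\<close>

lemma null_sets_INT:
  fixes N :: "nat \<Rightarrow> seq set"
  assumes N: "\<And>b. N b \<in> sets coin" "\<And>b. measure coin (N b) \<le> g b" and g: "g \<longlonglongrightarrow> 0"
  shows "(\<Inter>b. N b) \<in> null_sets coin"
proof -
  have sets: "(\<Inter>b. N b) \<in> sets coin" using N(1) by (intro sets.countable_INT) auto
  have "measure coin (\<Inter>b. N b) \<le> g b" for b
  proof -
    have "measure coin (\<Inter>b. N b) \<le> measure coin (N b)"
      using N(1) by (intro coin.finite_measure_mono) auto
    also note N(2)
    finally show ?thesis .
  qed
  then have "measure coin (\<Inter>b. N b) \<le> 0" by (intro LIMSEQ_le_const[OF g]) blast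
  then have "measure coin (\<Inter>b. N b) = 0" using measure_nonneg by (intro antisym)
  then show ?thesis using sets by (intro null_setsI) (simp_all add: coin.emeasure_eq_measure)
qed

lemma complex_outputs_null:
  assumes "0 < A"
  shows "\<exists>N\<in>null_sets coin. {X. \<exists>\<omega>. (\<forall>n. ev X f n (of_bool (\<omega> n))) \<and>
       (\<forall>k n. real n / real A - real C \<le> K (substr \<omega> k n))} \<subseteq> N"
proof -
  define E where "E = {X. \<exists>\<omega>. (\<forall>n. ev X f n (of_bool (\<omega> n))) \<and>
       (\<forall>k n. real n / real A - real C \<le> K (substr \<omega> k n))}"
  have "\<exists>N. N \<in> sets coin \<and> measure coin N \<le> 4 / real (Suc b) \<and> E \<subseteq> N" for b
    using complex_outputs_cover[OF assms zero_less_Suc[of b], of f C] unfolding E_def[symmetric] by blast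
  then obtain N where N: "\<And>b. N b \<in> sets coin" "\<And>b. measure coin (N b) \<le> 4 / real (Suc b)"
    "\<And>b. E \<subseteq> N b"
    by metis
  have "(\<lambda>b. 4 / real (Suc b)) \<longlonglongrightarrow> 0" by real_asymp
  then have "(\<Inter>b. N b) \<in> null_sets coin" using N(1,2) by (rule null_sets_INT[rotated 2])
  moreover have "E \<subseteq> (\<Inter>b. N b)" using N(3) by (rule INT_greatest)
  ultimately show ?thesis unfolding E_def[symmetric] by (rule bexI[rotated])
qed

instance rf :: countable
  by countable_datatype

lemma sets_cylinders: "cylinders S \<in> sets coin"
proof -
  have "{X. is_prefix_of \<sigma> X} = {X. \<forall>i<length \<sigma>. X i \<longleftrightarrow> \<sigma> ! i}" for \<sigma>
    unfolding is_prefix_of_def list_eq_iff_nth_eq by simp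
  then have "{X. is_prefix_of \<sigma> X} \<in> sets coin" for \<sigma>
    using coin_agree[of "length \<sigma>" "(!) \<sigma>"] by simp
  moreover have "cylinders S = (\<Union>\<sigma>\<in>S. {X. is_prefix_of \<sigma> X})" by (auto simp: cylinders_def)
  ultimately show ?thesis by (simp add: sets.countable_UN'' countable_subset)
qed

lemma MLtest_null:
  assumes "MLtest W" shows "(\<Inter>n. cylinders (test_level W n)) \<in> null_sets coin"
proof (rule null_sets_INT[OF sets_cylinders])
  show "measure coin (cylinders (test_level W n)) \<le> (1/2) ^ n" for n
    using assms by (simp add: MLtest_def)
qed real_asymp

text \<open>Every c.e. set is \<open>W f\<close> for one of countably many programs
  \<open>f\<close>, so the null sets of all tests can be avoided simultaneously.\<close>

lemma AE_MLrandom: "AE X in coin. MLrandom X"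
proof -
  define W where "W f = {x. \<exists>y. ev (\<lambda>_. False) f x y}" for f
  have "AE X in coin. \<forall>f. MLtest (W f) \<longrightarrow> \<not> (\<forall>n. X \<in> cylinders (test_level (W f) n))"
  proof (subst AE_all_countable, intro allI)
    fix f
    show "AE X in coin. MLtest (W f) \<longrightarrow> \<not> (\<forall>n. X \<in> cylinders (test_level (W f) n))"
      using AE_not_in[OF MLtest_null[of "W f"]] by (cases "MLtest (W f)") auto
  qed
  then show ?thesis
  proof (rule AE_mp, intro AE_I2 impI)
    fix X assume *: "\<forall>f. MLtest (W f) \<longrightarrow> \<not> (\<forall>n. X \<in> cylinders (test_level (W f) n))"
    show "MLrandom X"
      unfolding MLrandom_def
    proof (intro allI impI)
      fix V assume V: "MLtest V"
      then obtain f where "V = W f" unfolding MLtest_def ce_set_def W_def by blast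
      with * V show "\<not> (\<forall>n. X \<in> cylinders (test_level V n))" by blast
    qed
  qed
qed

lemma AE_not_computes_complex:
  "AE X in coin. \<forall>f A C \<omega>. (\<forall>n. ev X f n (of_bool (\<omega> n))) \<longrightarrow>
     \<not> (\<forall>k n. real n / real (Suc A) - real C \<le> K (substr \<omega> k n))"
proof (simp only: AE_all_countable, intro allI)
  fix f A C
  obtain N where "N \<in> null_sets coin" "{X. \<exists>\<omega>. (\<forall>n. ev X f n (of_bool (\<omega> n))) \<and>
       (\<forall>k n. real n / real (Suc A) - real C \<le> K (substr \<omega> k n))} \<subseteq> N"
    using complex_outputs_null[of "Suc A" f C] by blast
  then show "AE X in coin. \<forall>\<omega>. (\<forall>n. ev X f n (of_bool (\<omega> n))) \<longrightarrow>
     \<not> (\<forall>k n. real n / real (Suc A) - real C \<le> K (substr \<omega> k n))"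
    by (intro AE_I'[of N]) auto
qed

theorem theorem5:
  shows "\<exists>X. MLrandom X \<and>
           (\<forall>\<omega>. turing_reducible \<omega> X \<longrightarrow>
              \<not> (\<exists>\<alpha>. 0 < \<alpha> \<and> \<alpha> < 1 \<and> alpha_everywhere_complex \<alpha> \<omega>))"
proof -
  have "AE X in coin. MLrandom X \<and> (\<forall>f A C \<omega>. (\<forall>n. ev X f n (of_bool (\<omega> n))) \<longrightarrow>
     \<not> (\<forall>k n. real n / real (Suc A) - real C \<le> K (substr \<omega> k n)))"
    using AE_MLrandom AE_not_computes_complex by (rule AE_conjI)
  moreover have "ae_filter coin \<noteq> bot"
    using coin.emeasure_space_1 by (simp add: ae_filter_eq_bot_iff)
  ultimately obtain X where "MLrandom X \<and> (\<forall>f A C \<omega>. (\<forall>n. ev X f n (of_bool (\<omega> n))) \<longrightarrow>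
     \<not> (\<forall>k n. real n / real (Suc A) - real C \<le> K (substr \<omega> k n)))"
    using eventually_happens' by blast
  then have X: "MLrandom X" "\<And>f A C \<omega>. \<forall>n. ev X f n (of_bool (\<omega> n)) \<Longrightarrow>
     \<not> (\<forall>k n. real n / real (Suc A) - real C \<le> K (substr \<omega> k n))"
    by blast+
  have False if "turing_reducible \<omega> X" and \<alpha>: "0 < \<alpha>" and cpl: "alpha_everywhere_complex \<alpha> \<omega>" for \<omega> \<alpha>
  proof -
    obtain f where f: "\<forall>n. ev X f n (of_bool (\<omega> n))"
      using \<open>turing_reducible \<omega> X\<close> unfolding turing_reducible_def of_bool_def by blast
    obtain c where c: "\<And>k n. \<alpha> * real n - c \<le> K (substr \<omega> k n)"
      using cpl unfolding alpha_everywhere_complex_def by blast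
    \<comment> \<open>The real rate and constant are weakened to \<open>1 / Suc A\<close> and a
      natural number \<open>C\<close>, one of the countably many cases already excluded.\<close>
    obtain A where A: "1 / real (Suc A) < \<alpha>" using nat_approx_posE[OF \<alpha>] by blast
    obtain C :: nat where C: "c \<le> C" using real_arch_simple by blast
    have "real n / real (Suc A) - real C \<le> K (substr \<omega> k n)" for k n
    proof -
      have "1 / real (Suc A) * real n \<le> \<alpha> * real n" using A by (intro mult_right_mono) auto
      then show ?thesis using c[of n k] C by simp
    qed
    with X(2)[OF f] show False by blast
  qed
  with X(1) show ?thesis by blast
qed

end
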